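(* Equip the simplex category $\Delta$ with the system of bicoverings consisting of the cospans $[m]\xrightarrow{s_m}[j]\xleftarrow{t_n}[n]$ with $n+m\geq j$. Then gleaves $\Delta^{\mathrm{op}}\to\mathbf{Set}$ on $\Delta$ with these bicoverings are compositories, and vice versa. Here the identification is as follows: the pullback of $[m]\xrightarrow{s_m}[j]\xleftarrow{t_n}[n]$ is $[k]$ with $k=m+n-j$ (with projections $t_k:[k]\to[m]$ and $s_k:[k]\to[n]$), so for a simplicial set $\mathcal{C}$ the elements of $\mathcal{C}([m])\times_{\mathcal{C}([k])}\mathcal{C}([n])$ are exactly the $k$-composable pairs $(A,B)\in\mathcal{C}(m)\times\mathcal{C}(n)$, and the gluing operation $g$ corresponds to the composition by $A\circ_k B=g(A,B)\in\mathcal{C}(m+n-k)$.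
   Context: **Simplicial conventions.** $\mathbb{N}$ includes $0$. $\Delta$ is the category of nonempty finite ordinals $[n]=\{0,\dots,n\}$, $n\in\mathbb{N}$, and order-preserving maps. A simplicial set is a functor $\mathcal{C}:\Delta^{\mathrm{op}}\to\mathbf{Set}$; write $\mathcal{C}(n)=\mathcal{C}([n])$, and for $f:[m]\to[n]$ and $A\in\mathcal{C}(n)$ write $Af:=\mathcal{C}(f)(A)\in\mathcal{C}(m)$. The map $\partial_k:[n-1]\to[n]$ is the injective order-preserving map omitting $k$; $\eta_k:[n+1]\to[n]$ is the surjective order-preserving map hitting $k$ twice. For $k\le n$, $s_k:[k]\to[n]$ is $v\mapsto v$ and $t_k:[k]\to[n]$ is $v\mapsto v+n-k$; the codomain index $n$ is left implicit. **Compositories.** A pair $(A,B)\in\mathcal{C}(m)\times\mathcal{C}(n)$ is $k$-composable if $At_k=Bs_k$. A compository is a simplicial set $\mathcal{C}$ equipped with an element $A\circ_k B\in\mathcal{C}(m+n-k)$ for every $k\in\mathbb{N}$ and every $k$-composable pair $(A,B)\in\mathcal{C}(m)\times\mathcal{C}(n)$, such that: 1. (Identity) $As_k\circ_k A=A$ and $A\circ_k At_k=A$. And for every $k$-composable $(A,B)\in\mathcal{C}(m)\times\mathcal{C}(n)$: 2. (Back-and-forth) $(A\circ_k B)s_{m+i}\circ_{k+i}B=A\circ_k B$ for $i\le n-k$; $A\circ_{k+j}(A\circ_k B)t_{n+j}=A\circ_k B$ for $j\le m-k$ ($i,j\ge 0$). 3. (Degeneracies) $(A\circ_k B)\eta_i=A\eta_i\circ_k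 B$ for $i\le m-k$; $(A\circ_k B)\eta_i=A\circ_k B\eta_{i-m+k}$ for $i\ge m$; $(A\circ_k B)\eta_i=A\eta_i\circ_{k+1}B\eta_{i-m+k}$ for $m-k\le i\le m$. 4. (Faces) $(A\circ_k B)\partial_i=A\partial_i\circ_k B$ for $i<m-k$; $(A\circ_k B)\partial_i=A\circ_k B\partial_{i-m+k}$ for $i>m$. **Systems of bicoverings.** A system of bicoverings on a category $\mathsf{C}$ is a collection of cospans $a\to c\leftarrow b$ in $\mathsf{C}$, called bicoverings, such that: 1. The two legs of a bicovering are monomorphisms. 2. Bicoverings can be completed to pullback squares. 3. (Maximal bicoverings) For every object $a$, the cospan $a=a=a$ is a bicovering. 4. (Stability under composition) If $a\to c\leftarrow b$ and $a'\to a\leftarrow a\times_c b$ are bicoverings, then so is the composed cospan $a'\to c\leftarrow b$. 5. (Stability under pullbacks) If $a\to c\leftarrow b$ is a bicovering and $f:c'\to c$ is a morphism such that the pullbacks $f^*(a)$ and $f^*(b)$ exist, then $f^*(a)\to c'\leftarrow f^*(b)$ is a bicovering. The two legs of a cospan are not distinguished: swapping them results in the same cospan. The collection of cospans on $\Delta$ in the claim is taken as a system of bicoverings in this sense. A morphism of bicoverings from $a'\to c'\leftarrow b'$ to $a\to c\leftarrow b$ consists of $q_a:a'\to a$, $q_b:b'\to b$, $q_c:c'\to c$ commuting with the legs, such that there exist arrows $a'\leftarrow a\times_c b\to b'$ making the completed diagram commute; equivalently, such that the induced map $a'\times_{c'}b'\to a\times_c b$ has a right inverse. **Gleaves.** Let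 $\mathsf{C}$ be a category equipped with a system of bicoverings. A gleaf on $\mathsf{C}$ with values in $\mathbf{Set}$ is a functor $\Gamma:\mathsf{C}^{\mathrm{op}}\to\mathbf{Set}$ together with a gluing operation $g:\Gamma(a)\times_{\Gamma(a\times_c b)}\Gamma(b)\to\Gamma(c)$ for every bicovering $a\to c\leftarrow b$, such that: 1. (Identity) For a bicovering $a=a\leftarrow b$ (so $c=a$), $g=\pi_1:\Gamma(a)\times_{\Gamma(b)}\Gamma(b)\to\Gamma(a)$; for a bicovering $a\to b=b$ (so $c=b$), $g=\pi_2:\Gamma(a)\times_{\Gamma(a)}\Gamma(b)\to\Gamma(b)$. 2. (Back-and-forth) Given bicoverings $a\to c\leftarrow b$ and $a'\to a\leftarrow a\times_c b$, the composite $\Gamma(a')\times_{\Gamma(a'\times_c b)}\Gamma(b)\xrightarrow{g}\Gamma(c)\to\Gamma(a)\times_{\Gamma(a\times_c b)}\Gamma(b)\xrightarrow{g}\Gamma(c)$ (the middle arrow being restriction) equals $g:\Gamma(a')\times_{\Gamma(a'\times_c b)}\Gamma(b)\to\Gamma(c)$. 3. (Partial naturality) For every morphism of bicoverings $(q_a,q_b,q_c)$ from $a'\to c'\leftarrow b'$ to $a\to c\leftarrow b$, $\Gamma(q_c)\circ g=g\circ(\Gamma(q_a)\times\Gamma(q_b))$ as maps $\Gamma(a)\times_{\Gamma(a\times_c b)}\Gamma(b)\to\Gamma(c')$.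
   Formalization: The listed cospans are not stable under pullback (nor, with unordered legs, under composition), so they are not required to form a system of bicoverings; the gleaf back-and-forth axiom is imposed only when the composed cospan is itself one of the listed bicoverings. *)

theory Defs
  imports Main "HOL-Library.FuncSet"
begin

record ('o, 'a) category =
  Obj :: "'o set"
  Arr :: "'a set"
  Dom :: "'a \<Rightarrow> 'o"
  Cod :: "'a \<Rightarrow> 'o"
  Ident :: "'o \<Rightarrow> 'a"
  Comp :: "'a \<Rightarrow> 'a \<Rightarrow> 'a"  (infixr "\<cdot>\<index>" 70)

definition Hom :: "('o, 'a, 'z) category_scheme \<Rightarrow> 'o \<Rightarrow> 'o \<Rightarrow> 'a set" where
  "Hom C a b = {f \<in> Arr C. Dom C f = a \<and> Cod C f = b}"

text \<open>\<open>g \<cdot> f\<close> is \<open>g\<close> after \<open>f\<close>.\<close>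

locale category =
  fixes C :: "('o, 'a, 'z) category_scheme" (structure)
  assumes Dom_in: "f \<in> Arr C \<Longrightarrow> Dom C f \<in> Obj C"
    and Cod_in: "f \<in> Arr C \<Longrightarrow> Cod C f \<in> Obj C"
    and Ident_in: "a \<in> Obj C \<Longrightarrow> Ident C a \<in> Hom C a a"
    and Comp_in: "f \<in> Hom C a b \<Longrightarrow> g \<in> Hom C b c \<Longrightarrow> g \<cdot> f \<in> Hom C a c"
    and Comp_Ident: "f \<in> Hom C a b \<Longrightarrow> f \<cdot> Ident C a = f"
    and Ident_Comp: "f \<in> Hom C a b \<Longrightarrow> Ident C b \<cdot> f = f"
    and Comp_assoc: "f \<in> Hom C a b \<Longrightarrow> g \<in> Hom C b c \<Longrightarrow> h \<in> Hom C c d \<Longrightarrow>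
          (h \<cdot> g) \<cdot> f = h \<cdot> (g \<cdot> f)"

text \<open>\<open>p\<close> and \<open>q\<close> are the projections of a pullback of the cospan with legs \<open>f\<close> and \<open>g\<close>.\<close>

definition is_pullback ::
    "('o, 'a, 'z) category_scheme \<Rightarrow> 'a \<Rightarrow> 'a \<Rightarrow> 'a \<Rightarrow> 'a \<Rightarrow> bool" where
  "is_pullback C f g p q \<longleftrightarrow>
     f \<in> Arr C \<and> g \<in> Arr C \<and> Cod C f = Cod C g \<and>
     p \<in> Hom C (Dom C p) (Dom C f) \<and> q \<in> Hom C (Dom C p) (Dom C g) \<and>
     f \<cdot>\<^bsub>C\<^esub> p = g \<cdot>\<^bsub>C\<^esub> q \<and>
     (\<forall>x. \<forall>u \<in> Hom C x (Dom C f). \<forall>v \<in> Hom C x (Dom C g). f \<cdot>\<^bsub>C\<^esub> u = g \<cdot>\<^bsub>C\<^esub> v \<longrightarrow>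
        (\<exists>!w. w \<in> Hom C x (Dom C p) \<and> p \<cdot>\<^bsub>C\<^esub> w = u \<and> q \<cdot>\<^bsub>C\<^esub> w = v))"

text \<open>A functor from the opposite of \<open>C\<close> to sets, all of whose values are subsets of one
  type. The restriction maps are made extensional so that equal functors are equal records.\<close>

record ('o, 'a, 'x) presheaf =
  sec :: "'o \<Rightarrow> 'x set"
  res :: "'a \<Rightarrow> 'x \<Rightarrow> 'x"

locale presheaf = category C
  for C :: "('o, 'a, 'z) category_scheme" (structure) +
  fixes \<Gamma> :: "('o, 'a, 'x) presheaf"
  assumes sec_ext: "sec \<Gamma> \<in> extensional (Obj C)"
    and res_in: "res \<Gamma> \<in> (\<Pi>\<^sub>E f \<in> Arr C. sec \<Gamma> (Cod C f) \<rightarrow>\<^sub>E sec \<Gamma> (Dom C f))"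
    and res_Ident: "a \<in> Obj C \<Longrightarrow> A \<in> sec \<Gamma> a \<Longrightarrow> res \<Gamma> (Ident C a) A = A"
    and res_Comp: "f \<in> Hom C a b \<Longrightarrow> g \<in> Hom C b c \<Longrightarrow> A \<in> sec \<Gamma> c \<Longrightarrow>
          res \<Gamma> (g \<cdot> f) A = res \<Gamma> f (res \<Gamma> g A)"

text \<open>The fibre product of \<open>\<Gamma>(a)\<close> and \<open>\<Gamma>(b)\<close> over \<open>\<Gamma>(a \<times>\<^sub>c b)\<close>, for the cospan with legs
  \<open>f : a \<rightarrow> c\<close> and \<open>g : b \<rightarrow> c\<close>. It does not depend on which of the isomorphic pullbacks is used.\<close>

definition fibre_product ::
    "('o, 'a, 'z) category_scheme \<Rightarrow> ('o, 'a, 'x) presheaf \<Rightarrow> 'a \<Rightarrow> 'a \<Rightarrow> ('x \<times> 'x) set" where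
  "fibre_product C \<Gamma> f g =
     {(A, B). A \<in> sec \<Gamma> (Dom C f) \<and> B \<in> sec \<Gamma> (Dom C g) \<and>
        (\<exists>p q. is_pullback C f g p q \<and> res \<Gamma> p A = res \<Gamma> q B)}"

text \<open>Morphisms from the cospan \<open>(f', g')\<close> to the cospan \<open>(f, g)\<close>; \<open>u\<close> and \<open>v\<close> are the arrows
  from the pullback of \<open>(f, g)\<close> to the feet of \<open>(f', g')\<close>.\<close>

definition bicovering_morphism ::
    "('o, 'a, 'z) category_scheme \<Rightarrow> 'a \<Rightarrow> 'a \<Rightarrow> 'a \<Rightarrow> 'a \<Rightarrow> 'a \<Rightarrow> 'a \<Rightarrow> 'a \<Rightarrow> bool" where
  "bicovering_morphism C f' g' f g qa qb qc \<longleftrightarrow>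
     qa \<in> Hom C (Dom C f') (Dom C f) \<and>
     qb \<in> Hom C (Dom C g') (Dom C g) \<and>
     qc \<in> Hom C (Cod C f') (Cod C f) \<and>
     qc \<cdot>\<^bsub>C\<^esub> f' = f \<cdot>\<^bsub>C\<^esub> qa \<and> qc \<cdot>\<^bsub>C\<^esub> g' = g \<cdot>\<^bsub>C\<^esub> qb \<and>
     (\<exists>p q u v. is_pullback C f g p q \<and>
        u \<in> Hom C (Dom C p) (Dom C f') \<and> v \<in> Hom C (Dom C p) (Dom C g') \<and>
        f' \<cdot>\<^bsub>C\<^esub> u = g' \<cdot>\<^bsub>C\<^esub> v \<and> qa \<cdot>\<^bsub>C\<^esub> u = p \<and> qb \<cdot>\<^bsub>C\<^esub> v = q)"

text \<open>
  The bicoverings are a symmetric set \<open>J\<close> of pairs of legs: a cospan is unordered, so \<open>(f, g)\<close>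
  and \<open>(g, f)\<close> present the same bicovering, and \<open>glue_swap\<close> says that they carry the same
  gluing operation.

  No closure property of \<open>J\<close> is assumed, since the bicoverings used below are not stable under
  pullback: pulling the cospan \<open>{0,1} \<rightarrow> [2] \<leftarrow> {1,2}\<close> back along the map \<open>[1] \<rightarrow> [2]\<close> that omits
  \<open>1\<close> gives \<open>{0} \<rightarrow> [1] \<leftarrow> {1}\<close>. For the same reason \<open>back_and_forth\<close> states explicitly that the
  composed cospan is a bicovering; this premise is redundant when \<open>J\<close> is stable under composition.
\<close>

locale gleaf = presheaf C \<Gamma>
  for C :: "('o, 'a, 'z) category_scheme" (structure)
    and J :: "('a \<times> 'a) set"
    and \<Gamma> :: "('o, 'a, 'x) presheaf" +
  fixes glue :: "'a \<times> 'a \<Rightarrow> 'x \<times> 'x \<Rightarrow> 'x"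
  assumes glue_in:
      "glue \<in> (\<Pi>\<^sub>E (f, g) \<in> J. fibre_product C \<Gamma> f g \<rightarrow>\<^sub>E sec \<Gamma> (Cod C f))"
    and glue_swap:
      "(f, g) \<in> J \<Longrightarrow> (A, B) \<in> fibre_product C \<Gamma> f g \<Longrightarrow> glue (g, f) (B, A) = glue (f, g) (A, B)"
    and identity_left:
      "(Ident C a, g) \<in> J \<Longrightarrow> (A, B) \<in> fibre_product C \<Gamma> (Ident C a) g \<Longrightarrow>
       glue (Ident C a, g) (A, B) = A"
    and identity_right:
      "(f, Ident C b) \<in> J \<Longrightarrow> (A, B) \<in> fibre_product C \<Gamma> f (Ident C b) \<Longrightarrow>
       glue (f, Ident C b) (A, B) = B"
    and back_and_forth:
      "(f, g) \<in> J \<Longrightarrow> is_pullback C f g p q \<Longrightarrow> (h, p) \<in> J \<Longrightarrow> (f \<cdot> h, g) \<in> J \<Longrightarrow>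
       (A, B) \<in> fibre_product C \<Gamma> (f \<cdot> h) g \<Longrightarrow>
       glue (f, g) (res \<Gamma> f (glue (f \<cdot> h, g) (A, B)), res \<Gamma> g (glue (f \<cdot> h, g) (A, B)))
         = glue (f \<cdot> h, g) (A, B)"
    and partial_naturality:
      "(f', g') \<in> J \<Longrightarrow> (f, g) \<in> J \<Longrightarrow> bicovering_morphism C f' g' f g qa qb qc \<Longrightarrow>
       (A, B) \<in> fibre_product C \<Gamma> f g \<Longrightarrow>
       res \<Gamma> qc (glue (f, g) (A, B)) = glue (f', g') (res \<Gamma> qa A, res \<Gamma> qb B)"

text \<open>The object \<open>[n]\<close> is represented by the number \<open>n\<close>, and an arrow \<open>[m] \<rightarrow> [n]\<close> by the triple
  of \<open>m\<close>, \<open>n\<close> and an order-preserving function that is undefined outside \<open>{0..m}\<close>.\<close>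

type_synonym simplex_map = "nat \<times> nat \<times> (nat \<Rightarrow> nat)"

definition Delta :: "(nat, simplex_map) category" where
  "Delta = \<lparr>Obj = UNIV,
     Arr = {(m, n, f). f \<in> {0..m} \<rightarrow>\<^sub>E {0..n} \<and> mono_on {0..m} f},
     Dom = (\<lambda>(m, n, f). m),
     Cod = (\<lambda>(m, n, f). n),
     Ident = (\<lambda>n. (n, n, \<lambda>v\<in>{0..n}. v)),
     Comp = (\<lambda>(_, n, g) (m, _, f). (m, n, compose {0..m} g f))\<rparr>"

text \<open>The second argument of \<open>s\<close>, \<open>t\<close>, \<open>face\<close> and \<open>degen\<close> is the codomain.\<close>

definition s :: "nat \<Rightarrow> nat \<Rightarrow> simplex_map" where
  "s k n = (k, n, \<lambda>v\<in>{0..k}. v)"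

definition t :: "nat \<Rightarrow> nat \<Rightarrow> simplex_map" where
  "t k n = (k, n, \<lambda>v\<in>{0..k}. v + (n - k))"

definition face :: "nat \<Rightarrow> nat \<Rightarrow> simplex_map" where
  "face k n = (n - 1, n, \<lambda>v\<in>{0..n - 1}. if v < k then v else v + 1)"

definition degen :: "nat \<Rightarrow> nat \<Rightarrow> simplex_map" where
  "degen k n = (n + 1, n, \<lambda>v\<in>{0..n + 1}. if v \<le> k then v else v - 1)"

definition Delta_bicoverings :: "(simplex_map \<times> simplex_map) set" where
  "Delta_bicoverings =
     {(s m j, t n j) | m n j. m \<le> j \<and> n \<le> j \<and> j \<le> n + m} \<union>
     {(t n j, s m j) | m n j. m \<le> j \<and> n \<le> j \<and> j \<le> n + m}"

type_synonym 'x sset = "(nat, simplex_map, 'x) presheaf"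

abbreviation simplicial_set :: "'x sset \<Rightarrow> bool" where
  "simplicial_set C \<equiv> presheaf Delta C"

text \<open>The sets of simplices of different dimensions need not be disjoint, so the dimensions
  \<open>m\<close> and \<open>n\<close> are arguments here and in \<open>comp (k, m, n) (A, B)\<close>, which stands for \<open>A \<circ>\<^sub>k B\<close>.\<close>

definition composable_pairs :: "'x sset \<Rightarrow> nat \<Rightarrow> nat \<Rightarrow> nat \<Rightarrow> ('x \<times> 'x) set" where
  "composable_pairs C k m n =
     {(A, B). k \<le> m \<and> k \<le> n \<and> A \<in> sec C m \<and> B \<in> sec C n \<and> res C (t k m) A = res C (s k n) B}"

text \<open>The index \<open>i - m + k\<close> of a face or degeneracy of \<open>B\<close> is written \<open>i + k - m\<close> because of
  truncated subtraction. Upper bounds that are implicit in the existence of a face or degeneracy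
  map with index \<open>i\<close> are made explicit.\<close>

locale compository =
  fixes C :: "'x sset"
    and comp :: "nat \<times> nat \<times> nat \<Rightarrow> 'x \<times> 'x \<Rightarrow> 'x"
  assumes simplicial_set: "simplicial_set C"
    and comp_in:
      "comp \<in> (\<Pi>\<^sub>E (k, m, n) \<in> {(k, m, n). k \<le> m \<and> k \<le> n}.
                 composable_pairs C k m n \<rightarrow>\<^sub>E sec C (m + n - k))"
    and identity_left:
      "A \<in> sec C m \<Longrightarrow> k \<le> m \<Longrightarrow> comp (k, k, m) (res C (s k m) A, A) = A"
    and identity_right:
      "A \<in> sec C m \<Longrightarrow> k \<le> m \<Longrightarrow> comp (k, m, k) (A, res C (t k m) A) = A"
    and back_and_forth_left:
      "(A, B) \<in> composable_pairs C k m n \<Longrightarrow> i \<le> n - k \<Longrightarrow>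
       comp (k + i, m + i, n) (res C (s (m + i) (m + n - k)) (comp (k, m, n) (A, B)), B)
         = comp (k, m, n) (A, B)"
    and back_and_forth_right:
      "(A, B) \<in> composable_pairs C k m n \<Longrightarrow> j \<le> m - k \<Longrightarrow>
       comp (k + j, m, n + j) (A, res C (t (n + j) (m + n - k)) (comp (k, m, n) (A, B)))
         = comp (k, m, n) (A, B)"
    and degeneracy_left:
      "(A, B) \<in> composable_pairs C k m n \<Longrightarrow> i \<le> m - k \<Longrightarrow>
       res C (degen i (m + n - k)) (comp (k, m, n) (A, B))
         = comp (k, m + 1, n) (res C (degen i m) A, B)"
    and degeneracy_right:
      "(A, B) \<in> composable_pairs C k m n \<Longrightarrow> m \<le> i \<Longrightarrow> i \<le> m + n - k \<Longrightarrow>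
       res C (degen i (m + n - k)) (comp (k, m, n) (A, B))
         = comp (k, m, n + 1) (A, res C (degen (i + k - m) n) B)"
    and degeneracy_middle:
      "(A, B) \<in> composable_pairs C k m n \<Longrightarrow> m - k \<le> i \<Longrightarrow> i \<le> m \<Longrightarrow>
       res C (degen i (m + n - k)) (comp (k, m, n) (A, B))
         = comp (k + 1, m + 1, n + 1) (res C (degen i m) A, res C (degen (i + k - m) n) B)"
    and face_left:
      "(A, B) \<in> composable_pairs C k m n \<Longrightarrow> i < m - k \<Longrightarrow>
       res C (face i (m + n - k)) (comp (k, m, n) (A, B))
         = comp (k, m - 1, n) (res C (face i m) A, B)"
    and face_right:
      "(A, B) \<in> composable_pairs C k m n \<Longrightarrow> m < i \<Longrightarrow> i \<le> m + n - k \<Longrightarrow>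
       res C (face i (m + n - k)) (comp (k, m, n) (A, B))
         = comp (k, m, n - 1) (A, res C (face (i + k - m) n) B)"

definition composition_of_gluing ::
    "(simplex_map \<times> simplex_map \<Rightarrow> 'x \<times> 'x \<Rightarrow> 'x) \<Rightarrow> nat \<times> nat \<times> nat \<Rightarrow> 'x \<times> 'x \<Rightarrow> 'x" where
  "composition_of_gluing glue =
     (\<lambda>(k, m, n) \<in> {(k, m, n). k \<le> m \<and> k \<le> n}. glue (s m (m + n - k), t n (m + n - k)))"

end

theory Submission
  imports Defs
begin

text \<open>
  A bicovering of \<open>\<Delta>\<close> writes \<open>[j]\<close> as the union of an initial segment and a final segment which
  meet. It is determined by three numbers: the lengths \<open>a\<close> and \<open>b\<close> of the two parts outside the
  overlap, and the dimension \<open>k\<close> of the overlap, so that \<open>m = a + k\<close>, \<open>n = k + b\<close> and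
  \<open>j = a + k + b\<close>. Everything below is phrased in \<open>(a, k, b)\<close>, which removes truncated subtraction
  from the statements.

  Apart from the identity laws and the back-and-forth laws, which are nearly the same on both sides,
  the comparison is between partial naturality of a gluing and the laws for faces and degeneracies of
  a composition. A morphism of bicoverings is a single order-preserving map \<open>q\<close> that respects the two
  segments and maps overlap onto overlap (\<open>bicovering_morphism_of_map\<close> and
  \<open>map_of_bicovering_morphism\<close>). The face and degeneracy maps that occur in the laws of a compository
  have this property, which gives the passage from gleaves to compositories. Conversely, a map with
  this property is a composite of exactly these faces and degeneracies, by induction on the dimensions
  of its source and target: if \<open>q\<close> identifies two neighbours, a degeneracy splits off, and its position
  relative to the overlap decides which of the three degeneracy laws applies; if \<open>q\<close> misses a point,
  that point lies outside the overlap, and a face splits off; otherwise \<open>q\<close> is an identity. This is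
  \<open>compository.comp_natural\<close>.

  Since cospans are unordered, a morphism may also exchange the two legs. Then its image lies in the
  overlap, so it factors through the bicovering \<open>[k] = [k] = [k]\<close>, whose legs cannot be told apart,
  and naturality follows from the uncrossed case (\<open>compository.comp_natural_crossed\<close>).

  Pullbacks in \<open>\<Delta>\<close> of these cospans are unique on the nose, because an isomorphism in \<open>\<Delta>\<close> is an
  identity (\<open>pullback_s_t_unique\<close>). Hence the back-and-forth law of a gleaf speaks only about nested
  segments, and becomes the back-and-forth law of a compository once it is known that a composite
  restricts to its factors; this last fact is itself an instance of naturality.
\<close>

section \<open>Order-preserving maps between finite ordinals\<close>

definition order_preserving :: "nat \<Rightarrow> nat \<Rightarrow> (nat \<Rightarrow> nat) \<Rightarrow> bool" where
  "order_preserving m n q \<longleftrightarrow> (\<forall>v\<le>m. q v \<le> n) \<and> (\<forall>v w. v \<le> w \<longrightarrow> w \<le> m \<longrightarrow> q v \<le> q w)"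

text \<open>The values of \<open>q\<close> outside \<open>{0..m}\<close> are forgotten, so an arrow can be given by any closed formula,
  and equality of arrows (\<open>ordinal_map_eq_iff\<close>) is pointwise equality on \<open>{0..m}\<close>.\<close>

definition ordinal_map :: "nat \<Rightarrow> nat \<Rightarrow> (nat \<Rightarrow> nat) \<Rightarrow> simplex_map" where
  "ordinal_map m n q = (m, n, restrict q {0..m})"

lemma ordinal_map_eq_iff [simp]:
  "ordinal_map m n q = ordinal_map m' n' q' \<longleftrightarrow> m = m' \<and> n = n' \<and> (\<forall>v\<le>m. q v = q' v)"
  unfolding ordinal_map_def by (auto simp: restrict_def fun_eq_iff)

lemma ordinal_map_cong:
  "m = m' \<Longrightarrow> n = n' \<Longrightarrow> (\<And>v. v \<le> m' \<Longrightarrow> q v = q' v) \<Longrightarrow> ordinal_map m n q = ordinal_map m' n' q'"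
  by simp

lemma Dom_ordinal_map [simp]: "Dom Delta (ordinal_map m n q) = m"
  and Cod_ordinal_map [simp]: "Cod Delta (ordinal_map m n q) = n"
  by (simp_all add: ordinal_map_def Delta_def)

lemma ordinal_map_in_Arr [simp]: "ordinal_map m n q \<in> Arr Delta \<longleftrightarrow> order_preserving m n q"
  by (auto simp: ordinal_map_def Delta_def order_preserving_def mono_on_def PiE_iff)

lemma ordinal_map_in_Hom [simp]:
  "ordinal_map m n q \<in> Hom Delta m' n' \<longleftrightarrow> m = m' \<and> n = n' \<and> order_preserving m n q"
  by (auto simp: Hom_def)

lemma Hom_DeltaE:
  assumes "f \<in> Hom Delta m n"
  obtains q where "f = ordinal_map m n q" "order_preserving m n q"
proof -
  obtain q where q: "f = (m, n, q)" "q \<in> {0..m} \<rightarrow>\<^sub>E {0..n}" "mono_on {0..m} q"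
    using assms by (auto simp: Hom_def Delta_def)
  have "f = ordinal_map m n q"
    using q by (auto simp: ordinal_map_def PiE_restrict)
  moreover have "order_preserving m n q"
    using q by (auto simp: order_preserving_def mono_on_def PiE_iff)
  ultimately show thesis using that by blast
qed

lemma Comp_ordinal_map [simp]:
  "order_preserving l m f \<Longrightarrow>
   ordinal_map m n g \<cdot>\<^bsub>Delta\<^esub> ordinal_map l m f = ordinal_map l n (\<lambda>v. g (f v))"
  by (auto simp: ordinal_map_def Delta_def order_preserving_def compose_def restrict_def fun_eq_iff)

lemma Ident_eq: "Ident Delta n = ordinal_map n n (\<lambda>v. v)"
  by (simp add: Delta_def ordinal_map_def)

lemma s_eq: "s k n = ordinal_map k n (\<lambda>v. v)"
  by (simp add: s_def ordinal_map_def)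

lemma t_eq: "t k n = ordinal_map k n (\<lambda>v. v + (n - k))"
  by (simp add: t_def ordinal_map_def)

lemma face_eq: "face i (Suc n) = ordinal_map n (Suc n) (\<lambda>v. if v < i then v else v + 1)"
  by (simp add: face_def ordinal_map_def)

lemma degen_eq: "degen i n = ordinal_map (Suc n) n (\<lambda>v. if v \<le> i then v else v - 1)"
  by (simp add: degen_def ordinal_map_def)

lemma order_preserving_s [simp]: "order_preserving k n (\<lambda>v. v) \<longleftrightarrow> k \<le> n"
  by (auto simp: order_preserving_def)

lemma order_preserving_shift [simp]: "order_preserving k n (\<lambda>v. v + a) \<longleftrightarrow> k + a \<le> n"
  by (auto simp: order_preserving_def)

lemma Dom_Cod_s_t [simp]:
  "Dom Delta (s k n) = k" "Cod Delta (s k n) = n" "Dom Delta (t k n) = k" "Cod Delta (t k n) = n"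
  by (simp_all add: s_eq t_eq)

text \<open>A map that never repeats a value grows by at least one at each step, and one that moreover hits
  every value has no room to grow faster. This is the rigidity of finite ordinals.\<close>

lemma surjective_strict_is_identity:
  fixes q :: "nat \<Rightarrow> nat"
  assumes op: "order_preserving l m q"
    and strict: "\<And>v. v < l \<Longrightarrow> q v \<noteq> q (Suc v)"
    and surj: "\<And>x. x \<le> m \<Longrightarrow> \<exists>v\<le>l. q v = x"
  shows "l = m" "v \<le> l \<Longrightarrow> q v = v"
proof -
  have grow: "v + d \<le> l \<Longrightarrow> q v + d \<le> q (v + d)" for v d
  proof (induction d)
    case (Suc d)
    have "q (v + d) \<le> q (Suc (v + d))" using op Suc.prems by (simp add: order_preserving_def)
    moreover have "q (v + d) \<noteq> q (Suc (v + d))" using strict Suc.prems by simp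
    ultimately show ?case using Suc by simp
  qed simp
  have "{..m} \<subseteq> q ` {..l}" using surj by force
  then have "card {..m} \<le> card {..l}" by (rule surj_card_le[OF finite_atMost])
  then have "m \<le> l" by simp
  moreover have ql: "q l \<le> m" using op by (simp add: order_preserving_def)
  moreover have "l \<le> q l" using grow[of 0 l] by simp
  ultimately show "l = m" by simp
  show "q v = v" if "v \<le> l"
    using grow[of 0 v] grow[of v "l - v"] that ql \<open>l = m\<close> by simp
qed

section \<open>Pullbacks of an initial and a final segment\<close>

text \<open>The two segments \<open>{0..a + k}\<close> and \<open>{a..a + k + b}\<close> intersect in \<open>{a..a + k}\<close>; a compatible pair of
  maps into the segments is determined by its second component, which then takes values in \<open>[k]\<close>.\<close>

lemma pullback_s_t:
  "is_pullback Delta (s (a + k) (a + k + b)) (t (k + b) (a + k + b)) (t k (a + k)) (s k (k + b))"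
proof -
  have "\<exists>!w. w \<in> Hom Delta x k \<and> t k (a + k) \<cdot>\<^bsub>Delta\<^esub> w = u \<and> s k (k + b) \<cdot>\<^bsub>Delta\<^esub> w = v"
    if u: "u \<in> Hom Delta x (a + k)" and v: "v \<in> Hom Delta x (k + b)"
      and eq: "s (a + k) (a + k + b) \<cdot>\<^bsub>Delta\<^esub> u = t (k + b) (a + k + b) \<cdot>\<^bsub>Delta\<^esub> v" for x u v
  proof -
    obtain u' where u': "u = ordinal_map x (a + k) u'" "order_preserving x (a + k) u'"
      using u by (rule Hom_DeltaE)
    obtain v' where v': "v = ordinal_map x (k + b) v'" "order_preserving x (k + b) v'"
      using v by (rule Hom_DeltaE)
    have e: "u' y = v' y + a" if "y \<le> x" for y
      using eq u' v' that by (simp add: s_eq t_eq)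
    have op: "order_preserving x k v'"
      using u' v' e unfolding order_preserving_def by (simp add: add.commute)
    show ?thesis
    proof (rule ex1I[of _ "ordinal_map x k v'"])
      show "ordinal_map x k v' \<in> Hom Delta x k \<and>
        t k (a + k) \<cdot>\<^bsub>Delta\<^esub> ordinal_map x k v' = u \<and> s k (k + b) \<cdot>\<^bsub>Delta\<^esub> ordinal_map x k v' = v"
        using op u' v' e by (simp add: s_eq t_eq)
    next
      fix w
      assume "w \<in> Hom Delta x k \<and> t k (a + k) \<cdot>\<^bsub>Delta\<^esub> w = u \<and> s k (k + b) \<cdot>\<^bsub>Delta\<^esub> w = v"
      then show "w = ordinal_map x k v'"
        using v' by (auto elim!: Hom_DeltaE simp: s_eq)
    qed
  qed
  then show ?thesis
    by (simp add: is_pullback_def s_eq t_eq)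
qed

lemma cospan_indices:
  assumes "m \<le> j" "n \<le> j" "j \<le> n + m"
  obtains a k b :: nat where "m = a + k" "n = k + b" "j = a + k + b" "m + n - j = k"
  using assms by (intro that[of "j - n" "m + n - j" "j - m"]) auto

lemma overlap_indices:
  assumes "k \<le> m" "k \<le> n"
  obtains a b :: nat where "m = a + k" "n = k + b" "m + n - k = a + k + b"
  using assms by (intro that[of "m - k" "n - k"]) auto

lemma pullback_factors:
  assumes "is_pullback C f g p q" and "is_pullback C f g p' q'"
  obtains w where "w \<in> Hom C (Dom C p') (Dom C p)" "p \<cdot>\<^bsub>C\<^esub> w = p'" "q \<cdot>\<^bsub>C\<^esub> w = q'"
proof -
  have "\<exists>!w. w \<in> Hom C (Dom C p') (Dom C p) \<and> p \<cdot>\<^bsub>C\<^esub> w = p' \<and> q \<cdot>\<^bsub>C\<^esub> w = q'"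
    using assms unfolding is_pullback_def by simp
  then show thesis using that by auto
qed

lemma pullback_s_t_factors:
  assumes "is_pullback Delta (s (a + k) (a + k + b)) (t (k + b) (a + k + b)) p q"
  obtains w where "w \<in> Hom Delta k (Dom Delta p)"
    "p \<cdot>\<^bsub>Delta\<^esub> w = t k (a + k)" "q \<cdot>\<^bsub>Delta\<^esub> w = s k (k + b)"
  using pullback_factors[OF assms pullback_s_t] that by (metis Dom_Cod_s_t(3))

text \<open>The second projection of an arbitrary pullback corestricts to a map \<open>q'\<close> onto \<open>[k]\<close>. It takes no
  value twice, since two points of the apex with the same image would be two lifts of one cone over
  \<open>[0]\<close>. So \<open>q'\<close> is an identity.\<close>

lemma pullback_s_t_unique:
  assumes pb: "is_pullback Delta (s (a + k) (a + k + b)) (t (k + b) (a + k + b)) p q"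
  shows "p = t k (a + k)" "q = s k (k + b)"
proof -
  obtain d where d: "Dom Delta p = d" by simp
  have H: "p \<in> Hom Delta d (a + k)" "q \<in> Hom Delta d (k + b)"
    using pb by (simp_all add: is_pullback_def d)
  obtain p' where p': "p = ordinal_map d (a + k) p'" "order_preserving d (a + k) p'"
    using H(1) by (rule Hom_DeltaE)
  obtain q' where q': "q = ordinal_map d (k + b) q'" "order_preserving d (k + b) q'"
    using H(2) by (rule Hom_DeltaE)
  have sq: "p' v = q' v + a" if "v \<le> d" for v
    using pb that p' q' by (simp add: is_pullback_def s_eq t_eq)
  have op: "order_preserving d k q'"
    using q'(2) p'(2) sq by (auto simp: order_preserving_def)
  obtain w where w: "w \<in> Hom Delta k d" "q \<cdot>\<^bsub>Delta\<^esub> w = s k (k + b)"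
    by (rule pullback_s_t_factors[OF pb, unfolded d]) (rule that)
  obtain w' where w': "w = ordinal_map k d w'" "order_preserving k d w'"
    using w(1) by (rule Hom_DeltaE)
  have qw: "q' (w' x) = x" if "x \<le> k" for x
    using w(2) w' q' that by (simp add: s_eq)
  have inj: "q' v \<noteq> q' (Suc v)" if v: "v < d" for v
  proof
    assume eq: "q' v = q' (Suc v)"
    \<comment> \<open>The two points \<open>v\<close> and \<open>v + 1\<close> of the apex are lifts of the same cone over \<open>[0]\<close>.\<close>
    let ?pt = "\<lambda>x. ordinal_map 0 d (\<lambda>_. x)"
    have pt: "?pt x \<in> Hom Delta 0 d \<and> p \<cdot>\<^bsub>Delta\<^esub> ?pt x = ordinal_map 0 (a + k) (\<lambda>_. p' v)
        \<and> q \<cdot>\<^bsub>Delta\<^esub> ?pt x = ordinal_map 0 (k + b) (\<lambda>_. q' v)"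
      if "x \<in> {v, Suc v}" for x
    proof -
      have "x \<le> d" "q' x = q' v" using that v eq by auto
      moreover from this have "p' x = p' v" using sq v by simp
      moreover have "order_preserving 0 d (\<lambda>_. x)" using \<open>x \<le> d\<close> by (simp add: order_preserving_def)
      ultimately show ?thesis using p'(1) q'(1) by simp
    qed
    have "\<exists>!u. u \<in> Hom Delta 0 d \<and> p \<cdot>\<^bsub>Delta\<^esub> u = ordinal_map 0 (a + k) (\<lambda>_. p' v)
        \<and> q \<cdot>\<^bsub>Delta\<^esub> u = ordinal_map 0 (k + b) (\<lambda>_. q' v)"
    proof -
      have o: "order_preserving 0 (a + k) (\<lambda>_. p' v)" "order_preserving 0 (k + b) (\<lambda>_. q' v)"
        using p'(2) q'(2) v by (simp_all add: order_preserving_def)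
      have "\<forall>u\<in>Hom Delta 0 (a + k). \<forall>u'\<in>Hom Delta 0 (k + b).
          s (a + k) (a + k + b) \<cdot>\<^bsub>Delta\<^esub> u = t (k + b) (a + k + b) \<cdot>\<^bsub>Delta\<^esub> u' \<longrightarrow>
          (\<exists>!w. w \<in> Hom Delta 0 d \<and> p \<cdot>\<^bsub>Delta\<^esub> w = u \<and> q \<cdot>\<^bsub>Delta\<^esub> w = u')"
        using pb unfolding is_pullback_def d Dom_Cod_s_t by blast
      from bspec[OF bspec[OF this, of "ordinal_map 0 (a + k) (\<lambda>_. p' v)"], of "ordinal_map 0 (k + b) (\<lambda>_. q' v)"]
      show ?thesis using o sq[of v] v by (simp only: ordinal_map_in_Hom s_eq t_eq Comp_ordinal_map) simp
    qed
    moreover have "x = y" if "\<exists>!x. P x" "P x" "P y" for P and x y :: simplex_map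
      using that by blast
    ultimately have "?pt v = ?pt (Suc v)" using pt[of v] pt[of "Suc v"] by blast
    then show False by (auto dest: spec[of _ 0])
  qed
  have surj: "\<exists>v\<le>d. q' v = x" if "x \<le> k" for x
    using qw[OF that] w'(2) that unfolding order_preserving_def by blast
  note id = surjective_strict_is_identity[OF op inj surj]
  show "q = s k (k + b)" "p = t k (a + k)"
    using id sq p'(1) q'(1) by (simp_all add: s_eq t_eq)
qed

lemma is_pullback_swap:
  assumes "is_pullback C f g p q"
  shows "is_pullback C g f q p"
proof -
  have dom: "Dom C q = Dom C p"
    using assms by (simp add: is_pullback_def Hom_def)
  have "\<exists>!w. w \<in> Hom C x (Dom C q) \<and> q \<cdot>\<^bsub>C\<^esub> w = v \<and> p \<cdot>\<^bsub>C\<^esub> w = u"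
    if "u \<in> Hom C x (Dom C f)" "v \<in> Hom C x (Dom C g)" "g \<cdot>\<^bsub>C\<^esub> v = f \<cdot>\<^bsub>C\<^esub> u" for x u v
  proof -
    have "\<exists>!w. w \<in> Hom C x (Dom C p) \<and> p \<cdot>\<^bsub>C\<^esub> w = u \<and> q \<cdot>\<^bsub>C\<^esub> w = v"
      using assms that unfolding is_pullback_def by simp
    moreover have "(\<lambda>w. w \<in> Hom C x (Dom C p) \<and> p \<cdot>\<^bsub>C\<^esub> w = u \<and> q \<cdot>\<^bsub>C\<^esub> w = v)
        = (\<lambda>w. w \<in> Hom C x (Dom C q) \<and> q \<cdot>\<^bsub>C\<^esub> w = v \<and> p \<cdot>\<^bsub>C\<^esub> w = u)"
      unfolding dom by (intro ext) blast
    ultimately show ?thesis by simp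
  qed
  then show ?thesis
    using assms dom unfolding is_pullback_def by simp
qed

lemma fibre_product_swap:
  "(B, A) \<in> fibre_product C \<Gamma> g f \<longleftrightarrow> (A, B) \<in> fibre_product C \<Gamma> f g"
  unfolding fibre_product_def mem_Collect_eq prod.case
  using is_pullback_swap[of C g f] is_pullback_swap[of C f g] by (intro iffI; elim conjE exE; fastforce)

section \<open>Morphisms between bicoverings of \<open>\<Delta>\<close>\<close>

lemma initial_final_bicovering: "(s (a + k) (a + k + b), t (k + b) (a + k + b)) \<in> Delta_bicoverings"
proof -
  have "a + k \<le> a + k + b" "k + b \<le> a + k + b" "a + k + b \<le> (k + b) + (a + k)" by simp_all
  then show ?thesis unfolding Delta_bicoverings_def by blast
qed

lemma final_initial_bicovering: "(t (k + b) (a + k + b), s (a + k) (a + k + b)) \<in> Delta_bicoverings"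
proof -
  have "a + k \<le> a + k + b" "k + b \<le> a + k + b" "a + k + b \<le> (k + b) + (a + k)" by simp_all
  then show ?thesis unfolding Delta_bicoverings_def by blast
qed

lemma Delta_bicoveringsE:
  assumes "(f, g) \<in> Delta_bicoverings"
  obtains (initial_final) a k b where "f = s (a + k) (a + k + b)" "g = t (k + b) (a + k + b)"
  | (final_initial) a k b where "f = t (k + b) (a + k + b)" "g = s (a + k) (a + k + b)"
proof -
  from assms consider m n j where "f = s m j" "g = t n j" "m \<le> j" "n \<le> j" "j \<le> n + m"
    | m n j where "f = t n j" "g = s m j" "m \<le> j" "n \<le> j" "j \<le> n + m"
    unfolding Delta_bicoverings_def by blast
  then show thesis
  proof cases
    case 1
    show thesis by (rule cospan_indices[OF 1(3-5)]) (rule initial_final, simp_all add: 1)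
  next
    case 2
    show thesis by (rule cospan_indices[OF 2(3-5)]) (rule final_initial, simp_all add: 2)
  qed
qed

text \<open>The cospan with parameters \<open>(a, k, b)\<close> covers \<open>[a + k + b]\<close> by \<open>{0..a + k}\<close> and
  \<open>{a..a + k + b}\<close>. For a monotone \<open>q\<close> it is enough to look at the end points \<open>a' + k'\<close> and \<open>a'\<close> of the
  segments to see that each segment is mapped into its counterpart. The last condition
  amounts, by monotonicity, to the section over the overlap that a morphism of bicoverings must have.\<close>

definition preserves_overlap :: "nat \<Rightarrow> nat \<Rightarrow> nat \<Rightarrow> nat \<Rightarrow> nat \<Rightarrow> nat \<Rightarrow> (nat \<Rightarrow> nat) \<Rightarrow> bool" where
  "preserves_overlap a' k' b' a k b q \<longleftrightarrow>
     order_preserving (a' + k' + b') (a + k + b) q \<and>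
     q (a' + k') \<le> a + k \<and> a \<le> q a' \<and>
     (\<forall>x. a \<le> x \<longrightarrow> x \<le> a + k \<longrightarrow> (\<exists>y. a' \<le> y \<and> y \<le> a' + k' \<and> q y = x))"

lemma preserves_overlapD:
  assumes "preserves_overlap a' k' b' a k b q"
  shows "order_preserving (a' + k' + b') (a + k + b) q"
    and "order_preserving (a' + k') (a + k) q"
    and "order_preserving (k' + b') (k + b) (\<lambda>v. q (v + a') - a)"
    and "a' \<le> v \<Longrightarrow> v \<le> a' + k' + b' \<Longrightarrow> a \<le> q v"
    and "v \<le> a' + k' \<Longrightarrow> q v \<le> a + k"
proof -
  have l: "q (a' + k') \<le> a + k" and r: "a \<le> q a'"
    using assms by (auto simp: preserves_overlap_def)
  show op: "order_preserving (a' + k' + b') (a + k + b) q"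
    using assms by (auto simp: preserves_overlap_def)
  have bd: "\<And>v. v \<le> a' + k' + b' \<Longrightarrow> q v \<le> a + k + b"
    and mo: "\<And>v w. v \<le> w \<Longrightarrow> w \<le> a' + k' + b' \<Longrightarrow> q v \<le> q w"
    using op by (auto simp: order_preserving_def)
  show "a \<le> q v" if "a' \<le> v" "v \<le> a' + k' + b'" for v
    using mo[of a' v] r that by linarith
  show "q v \<le> a + k" if "v \<le> a' + k'" for v
    using mo[of v "a' + k'"] l that by linarith
  then show "order_preserving (a' + k') (a + k) q"
    unfolding order_preserving_def using mo by (meson le_add1 le_trans)
  show "order_preserving (k' + b') (k + b) (\<lambda>v. q (v + a') - a)"
    unfolding order_preserving_def
  proof (intro conjI allI impI)
    fix v assume "v \<le> k' + b'" then show "q (v + a') - a \<le> k + b"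
      using bd[of "v + a'"] by linarith
  next
    fix v w assume "v \<le> w" "w \<le> k' + b'" then show "q (v + a') - a \<le> q (w + a') - a"
      using mo[of "v + a'" "w + a'"] by linarith
  qed
qed

text \<open>The next five lemmas are the positions of a degeneracy or face for which a compository has a law.
  In the first and third of them the point that is doubled may belong to the overlap: the copy
  of the end point of the overlap that lies further out is then counted with the outer part.\<close>

lemma preserves_overlap_degen_left:
  assumes "i \<le> a"
  shows "preserves_overlap (Suc a) k b a k b (\<lambda>v. if v \<le> i then v else v - 1)"
proof -
  have "\<exists>y. Suc a \<le> y \<and> y \<le> Suc a + k \<and> (if y \<le> i then y else y - 1) = x" if "a \<le> x" "x \<le> a + k" for x
    using that assms by (intro exI[of _ "Suc x"]) auto
  then show ?thesis
    using assms unfolding preserves_overlap_def by (auto simp: order_preserving_def)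
qed

lemma preserves_overlap_degen_middle:
  assumes "a \<le> i" "i \<le> a + k"
  shows "preserves_overlap a (Suc k) b a k b (\<lambda>v. if v \<le> i then v else v - 1)"
proof -
  have "\<exists>y. a \<le> y \<and> y \<le> a + Suc k \<and> (if y \<le> i then y else y - 1) = x" if "a \<le> x" "x \<le> a + k" for x
    using that by (intro exI[of _ "if x \<le> i then x else Suc x"]) auto
  then show ?thesis
    using assms unfolding preserves_overlap_def by (auto simp: order_preserving_def)
qed

lemma preserves_overlap_degen_right:
  assumes "a + k \<le> i" "i \<le> a + k + b"
  shows "preserves_overlap a k (Suc b) a k b (\<lambda>v. if v \<le> i then v else v - 1)"
proof -
  have "\<exists>y. a \<le> y \<and> y \<le> a + k \<and> (if y \<le> i then y else y - 1) = x" if "a \<le> x" "x \<le> a + k" for x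
    using that assms by (intro exI[of _ x]) auto
  then show ?thesis
    using assms unfolding preserves_overlap_def by (auto simp: order_preserving_def)
qed

lemma preserves_overlap_face_left:
  assumes "i \<le> a"
  shows "preserves_overlap a k b (Suc a) k b (\<lambda>v. if v < i then v else v + 1)"
proof -
  have "\<exists>y. a \<le> y \<and> y \<le> a + k \<and> (if y < i then y else y + 1) = x" if "Suc a \<le> x" "x \<le> Suc a + k" for x
    using that assms by (intro exI[of _ "x - 1"]) auto
  then show ?thesis
    using assms unfolding preserves_overlap_def by (auto simp: order_preserving_def)
qed

lemma preserves_overlap_face_right:
  assumes "a + k < i"
  shows "preserves_overlap a k b a k (Suc b) (\<lambda>v. if v < i then v else v + 1)"
proof -
  have "\<exists>y. a \<le> y \<and> y \<le> a + k \<and> (if y < i then y else y + 1) = x" if "a \<le> x" "x \<le> a + k" for x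
    using that assms by (intro exI[of _ x]) auto
  then show ?thesis
    using assms unfolding preserves_overlap_def by (auto simp: order_preserving_def)
qed

text \<open>Naturality along this map and the identity law show that a composite restricts to its second
  factor.\<close>

lemma preserves_overlap_final: "preserves_overlap 0 k b a k b (\<lambda>v. v + a)"
proof -
  have "\<exists>y. 0 \<le> y \<and> y \<le> 0 + k \<and> y + a = x" if "a \<le> x" "x \<le> a + k" for x
    using that by (intro exI[of _ "x - a"]) auto
  then show ?thesis unfolding preserves_overlap_def by auto
qed

lemma bicovering_morphismE:
  assumes "bicovering_morphism C f' g' f g qa qb qc"
  obtains p q u v where
    "qa \<in> Hom C (Dom C f') (Dom C f)" "qb \<in> Hom C (Dom C g') (Dom C g)"
    "qc \<in> Hom C (Cod C f') (Cod C f)"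
    "qc \<cdot>\<^bsub>C\<^esub> f' = f \<cdot>\<^bsub>C\<^esub> qa" "qc \<cdot>\<^bsub>C\<^esub> g' = g \<cdot>\<^bsub>C\<^esub> qb"
    "is_pullback C f g p q" "u \<in> Hom C (Dom C p) (Dom C f')" "v \<in> Hom C (Dom C p) (Dom C g')"
    "f' \<cdot>\<^bsub>C\<^esub> u = g' \<cdot>\<^bsub>C\<^esub> v" "qa \<cdot>\<^bsub>C\<^esub> u = p" "qb \<cdot>\<^bsub>C\<^esub> v = q"
  using assms unfolding bicovering_morphism_def by blast

lemma bicovering_morphismI:
  assumes "qa \<in> Hom C (Dom C f') (Dom C f)" "qb \<in> Hom C (Dom C g') (Dom C g)"
    "qc \<in> Hom C (Cod C f') (Cod C f)"
    "qc \<cdot>\<^bsub>C\<^esub> f' = f \<cdot>\<^bsub>C\<^esub> qa" "qc \<cdot>\<^bsub>C\<^esub> g' = g \<cdot>\<^bsub>C\<^esub> qb"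
    "is_pullback C f g p q" "u \<in> Hom C (Dom C p) (Dom C f')" "v \<in> Hom C (Dom C p) (Dom C g')"
    "f' \<cdot>\<^bsub>C\<^esub> u = g' \<cdot>\<^bsub>C\<^esub> v" "qa \<cdot>\<^bsub>C\<^esub> u = p" "qb \<cdot>\<^bsub>C\<^esub> v = q"
  shows "bicovering_morphism C f' g' f g qa qb qc"
  using assms unfolding bicovering_morphism_def by blast

text \<open>Monotonicity turns any choice of preimages for the points of the overlap into a monotone section:
  distinct points have preimages in the same order.\<close>

lemma bicovering_morphism_of_map:
  assumes "preserves_overlap a' k' b' a k b q"
  shows "bicovering_morphism Delta
     (s (a' + k') (a' + k' + b')) (t (k' + b') (a' + k' + b'))
     (s (a + k) (a + k + b)) (t (k + b) (a + k + b))
     (ordinal_map (a' + k') (a + k) q) (ordinal_map (k' + b') (k + b) (\<lambda>v. q (v + a') - a))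
     (ordinal_map (a' + k' + b') (a + k + b) q)"
proof -
  note D = preserves_overlapD[OF assms]
  have ov: "\<And>x. a \<le> x \<Longrightarrow> x \<le> a + k \<Longrightarrow> \<exists>y. a' \<le> y \<and> y \<le> a' + k' \<and> q y = x"
    using assms by (auto simp: preserves_overlap_def)
  obtain y where y: "\<And>x. x \<le> k \<Longrightarrow> a' \<le> y x \<and> y x \<le> a' + k' \<and> q (y x) = a + x"
  proof -
    have "\<forall>x. \<exists>y. x \<le> k \<longrightarrow> a' \<le> y \<and> y \<le> a' + k' \<and> q y = a + x"
      using ov by (metis add_le_cancel_left le_add1)
    then show thesis using that by metis
  qed
  have ymo: "y v \<le> y w" if "v \<le> w" "w \<le> k" for v w
  proof (rule ccontr)
    assume "\<not> y v \<le> y w"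
    then have "q (y w) \<le> q (y v)" using D(2) y[of v] that unfolding order_preserving_def by (meson le_trans nat_le_linear)
    then have "v = w" using y[of v] y[of w] that by simp
    then show False using \<open>\<not> y v \<le> y w\<close> by simp
  qed
  have opu: "order_preserving k (a' + k') y" using y ymo by (simp add: order_preserving_def)
  have opv: "order_preserving k (k' + b') (\<lambda>v. y v - a')"
    unfolding order_preserving_def
  proof (intro conjI allI impI)
    fix v assume "v \<le> k" then show "y v - a' \<le> k' + b'" using y[of v] by linarith
  next
    fix v w assume "v \<le> w" "w \<le> k" then show "y v - a' \<le> y w - a'"
      using ymo by (simp add: diff_le_mono)
  qed
  show ?thesis
    by (rule bicovering_morphismI[OF _ _ _ _ _ pullback_s_t, where
          u = "ordinal_map k (a' + k') y" and v = "ordinal_map k (k' + b') (\<lambda>v. y v - a')"])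
      (use D(1-4) opu opv y in \<open>auto simp: s_eq t_eq\<close>)
qed

text \<open>Commutation with the legs forces \<open>qa\<close> and \<open>qb\<close> to be restrictions of \<open>qc\<close>, and the section over the
  pullback provides a preimage inside the overlap for every point of the overlap.\<close>

lemma map_of_bicovering_morphism:
  assumes "bicovering_morphism Delta
     (s (a' + k') (a' + k' + b')) (t (k' + b') (a' + k' + b'))
     (s (a + k) (a + k + b)) (t (k + b) (a + k + b)) qa qb qc"
  obtains q where "preserves_overlap a' k' b' a k b q"
    "qa = ordinal_map (a' + k') (a + k) q"
    "qb = ordinal_map (k' + b') (k + b) (\<lambda>v. q (v + a') - a)"
    "qc = ordinal_map (a' + k' + b') (a + k + b) q"
proof -
  obtain p p' u v where H: "qa \<in> Hom Delta (a' + k') (a + k)" "qb \<in> Hom Delta (k' + b') (k + b)"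
     "qc \<in> Hom Delta (a' + k' + b') (a + k + b)"
    and L: "qc \<cdot>\<^bsub>Delta\<^esub> s (a' + k') (a' + k' + b') = s (a + k) (a + k + b) \<cdot>\<^bsub>Delta\<^esub> qa"
    and R: "qc \<cdot>\<^bsub>Delta\<^esub> t (k' + b') (a' + k' + b') = t (k + b) (a + k + b) \<cdot>\<^bsub>Delta\<^esub> qb"
    and pb: "is_pullback Delta (s (a + k) (a + k + b)) (t (k + b) (a + k + b)) p p'"
    and uv: "u \<in> Hom Delta (Dom Delta p) (a' + k')" "v \<in> Hom Delta (Dom Delta p) (k' + b')"
    and sq: "s (a' + k') (a' + k' + b') \<cdot>\<^bsub>Delta\<^esub> u = t (k' + b') (a' + k' + b') \<cdot>\<^bsub>Delta\<^esub> v"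
    and up: "qa \<cdot>\<^bsub>Delta\<^esub> u = p"
    by (rule bicovering_morphismE[OF assms, unfolded Dom_Cod_s_t]) (rule that)
  obtain d where d: "Dom Delta p = d" by simp
  obtain w where w: "w \<in> Hom Delta k d" "p \<cdot>\<^bsub>Delta\<^esub> w = t k (a + k)"
    by (rule pullback_s_t_factors[OF pb, unfolded d]) (rule that)
  obtain f where f: "qa = ordinal_map (a' + k') (a + k) f" "order_preserving (a' + k') (a + k) f"
    using H(1) by (rule Hom_DeltaE)
  obtain g where g: "qb = ordinal_map (k' + b') (k + b) g" "order_preserving (k' + b') (k + b) g"
    using H(2) by (rule Hom_DeltaE)
  obtain q where q: "qc = ordinal_map (a' + k' + b') (a + k + b) q"
      "order_preserving (a' + k' + b') (a + k + b) q"
    using H(3) by (rule Hom_DeltaE)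
  obtain u' where u': "u = ordinal_map d (a' + k') u'" "order_preserving d (a' + k') u'"
    using uv(1)[unfolded d] by (rule Hom_DeltaE)
  obtain v' where v': "v = ordinal_map d (k' + b') v'" "order_preserving d (k' + b') v'"
    using uv(2)[unfolded d] by (rule Hom_DeltaE)
  obtain w' where w': "w = ordinal_map k d w'" "order_preserving k d w'"
    using w(1) by (rule Hom_DeltaE)
  have f_eq: "q x = f x" if "x \<le> a' + k'" for x
    using L f q that by (simp add: s_eq)
  have g_eq: "q (x + a') = g x + a" if "x \<le> k' + b'" for x
    using R g q that by (simp add: t_eq)
  have section_eq: "f (u' (w' x)) = x + a" if "x \<le> k" for x
  proof -
    have "p = ordinal_map d (a + k) (\<lambda>v. f (u' v))"
      unfolding up[symmetric] f(1) u'(1) using u'(2) by (rule Comp_ordinal_map)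
    then have "p \<cdot>\<^bsub>Delta\<^esub> w = ordinal_map k (a + k) (\<lambda>v. f (u' (w' v)))"
      using w' by simp
    then show ?thesis using w(2) that by (simp add: t_eq)
  qed
  have sq_eq: "u' y = v' y + a'" if "y \<le> d" for y
    using sq u' v' that by (simp add: s_eq t_eq)
  have "preserves_overlap a' k' b' a k b q"
    unfolding preserves_overlap_def
  proof (intro conjI allI impI)
    show "order_preserving (a' + k' + b') (a + k + b) q" by fact
    show "q (a' + k') \<le> a + k" using f_eq[of "a' + k'"] f(2) by (simp add: order_preserving_def)
    show "a \<le> q a'" using g_eq[of 0] by simp
    fix x assume x: "a \<le> x" "x \<le> a + k"
    define y where "y = w' (x - a)"
    have y: "y \<le> d" using w'(2) x by (simp add: y_def order_preserving_def)
    have uy: "u' y \<le> a' + k'" using u'(2) y by (simp add: order_preserving_def)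
    have "f (u' y) = x" using section_eq[of "x - a"] x by (simp add: y_def)
    then have "a' \<le> u' y \<and> u' y \<le> a' + k' \<and> q (u' y) = x"
      using sq_eq[OF y] f_eq[OF uy] uy by simp
    then show "\<exists>y. a' \<le> y \<and> y \<le> a' + k' \<and> q y = x" by blast
  qed
  then show thesis
    using that f g q f_eq g_eq by simp
qed

lemma bicovering_morphism_swap:
  assumes "bicovering_morphism C f' g' f g qa qb qc" and cod: "Cod C f' = Cod C g'"
  shows "bicovering_morphism C g' f' g f qb qa qc"
  using assms(1)
proof (rule bicovering_morphismE)
  fix p q u v
  assume *: "qa \<in> Hom C (Dom C f') (Dom C f)" "qb \<in> Hom C (Dom C g') (Dom C g)"
    "qc \<in> Hom C (Cod C f') (Cod C f)"
    "qc \<cdot>\<^bsub>C\<^esub> f' = f \<cdot>\<^bsub>C\<^esub> qa" "qc \<cdot>\<^bsub>C\<^esub> g' = g \<cdot>\<^bsub>C\<^esub> qb"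
    "is_pullback C f g p q" "u \<in> Hom C (Dom C p) (Dom C f')" "v \<in> Hom C (Dom C p) (Dom C g')"
    "f' \<cdot>\<^bsub>C\<^esub> u = g' \<cdot>\<^bsub>C\<^esub> v" "qa \<cdot>\<^bsub>C\<^esub> u = p" "qb \<cdot>\<^bsub>C\<^esub> v = q"
  have "Dom C q = Dom C p" "Cod C g = Cod C f"
    using *(6) by (simp_all add: is_pullback_def Hom_def)
  then show ?thesis
    using bicovering_morphismI[OF _ _ _ _ _ is_pullback_swap[OF *(6)]] * cod by metis
qed

section \<open>Composable pairs\<close>

context
  fixes C :: "'x sset"
  assumes C: "simplicial_set C"
begin

lemma res_in_sec:
  assumes "order_preserving m n q" "A \<in> sec C n"
  shows "res C (ordinal_map m n q) A \<in> sec C m"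
proof -
  have "res C (ordinal_map m n q) \<in> sec C (Cod Delta (ordinal_map m n q)) \<rightarrow>\<^sub>E sec C (Dom Delta (ordinal_map m n q))"
    using PiE_mem[OF presheaf.res_in[OF C], of "ordinal_map m n q"] assms by simp
  then show ?thesis using assms by auto
qed

lemma res_res:
  "order_preserving l m f \<Longrightarrow> order_preserving m n g \<Longrightarrow> A \<in> sec C n \<Longrightarrow>
   res C (ordinal_map l m f) (res C (ordinal_map m n g) A) = res C (ordinal_map l n (\<lambda>v. g (f v))) A"
  using presheaf.res_Comp[OF C, of "ordinal_map l m f" l m "ordinal_map m n g" n A] by simp

lemma res_id:
  assumes "A \<in> sec C n" "\<And>v. v \<le> n \<Longrightarrow> q v = v"
  shows "res C (ordinal_map n n q) A = A"
proof -
  have "ordinal_map n n q = Ident Delta n" using assms by (simp add: Ident_eq)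
  then show ?thesis using presheaf.res_Ident[OF C, of n A] assms by (simp add: Delta_def)
qed

lemma composable_pairs_iff:
  "(A, B) \<in> composable_pairs C k (a + k) (k + b) \<longleftrightarrow>
     A \<in> sec C (a + k) \<and> B \<in> sec C (k + b) \<and>
     res C (ordinal_map k (a + k) (\<lambda>v. v + a)) A = res C (ordinal_map k (k + b) (\<lambda>v. v)) B"
  by (auto simp: composable_pairs_def s_eq t_eq)

lemma fibre_product_s_t:
  "fibre_product Delta C (s (a + k) (a + k + b)) (t (k + b) (a + k + b)) = composable_pairs C k (a + k) (k + b)"
proof (intro set_eqI iffI)
  fix x assume "x \<in> fibre_product Delta C (s (a + k) (a + k + b)) (t (k + b) (a + k + b))"
  then obtain A B p q where x: "x = (A, B)" and A: "A \<in> sec C (a + k)" and B: "B \<in> sec C (k + b)"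
    and pb: "is_pullback Delta (s (a + k) (a + k + b)) (t (k + b) (a + k + b)) p q"
    and eq: "res C p A = res C q B"
    unfolding fibre_product_def mem_Collect_eq split_beta Dom_Cod_s_t by (metis prod.collapse)
  obtain w where w: "w \<in> Hom Delta k (Dom Delta p)"
    "p \<cdot>\<^bsub>Delta\<^esub> w = t k (a + k)" "q \<cdot>\<^bsub>Delta\<^esub> w = s k (k + b)"
    using pullback_s_t_factors[OF pb] by metis
  have pq: "p \<in> Hom Delta (Dom Delta p) (a + k)" "q \<in> Hom Delta (Dom Delta p) (k + b)"
    using pb by (simp_all add: is_pullback_def)
  have "res C (t k (a + k)) A = res C (s k (k + b)) B"
    using presheaf.res_Comp[OF C w(1) pq(1) A] presheaf.res_Comp[OF C w(1) pq(2) B] w eq by simp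
  then show "x \<in> composable_pairs C k (a + k) (k + b)"
    using x A B by (simp add: composable_pairs_def)
next
  fix x assume "x \<in> composable_pairs C k (a + k) (k + b)"
  then show "x \<in> fibre_product Delta C (s (a + k) (a + k + b)) (t (k + b) (a + k + b))"
    using pullback_s_t[of a k b]
    unfolding composable_pairs_def fibre_product_def Dom_Cod_s_t by blast
qed

lemma fibre_product_t_s:
  "(B, A) \<in> fibre_product Delta C (t (k + b) (a + k + b)) (s (a + k) (a + k + b))
     \<longleftrightarrow> (A, B) \<in> composable_pairs C k (a + k) (k + b)"
  unfolding fibre_product_s_t[symmetric] by (rule fibre_product_swap)

lemma composable_pairs_diagonal:
  "(A, B) \<in> composable_pairs C k k k \<longleftrightarrow> A \<in> sec C k \<and> B = A"
  using composable_pairs_iff[of A B k 0 0] by (auto simp: res_id)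

text \<open>Both legs of the overlap of the source are mapped through the map of overlaps \<open>[k'] \<rightarrow> [k]\<close> induced
  by \<open>q\<close>, where the two restrictions agree.\<close>

lemma composable_restrict:
  assumes q: "preserves_overlap a' k' b' a k b q" and AB: "(A, B) \<in> composable_pairs C k (a + k) (k + b)"
  shows "(res C (ordinal_map (a' + k') (a + k) q) A,
          res C (ordinal_map (k' + b') (k + b) (\<lambda>v. q (v + a') - a)) B)
         \<in> composable_pairs C k' (a' + k') (k' + b')"
proof -
  note D = preserves_overlapD[OF q]
  have A: "A \<in> sec C (a + k)" and B: "B \<in> sec C (k + b)"
    and eq: "res C (ordinal_map k (a + k) (\<lambda>v. v + a)) A = res C (ordinal_map k (k + b) (\<lambda>v. v)) B"
    using AB by (auto simp: composable_pairs_iff)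
  have r: "order_preserving k' k (\<lambda>v. q (v + a') - a)"
    unfolding order_preserving_def
  proof (intro conjI allI impI)
    fix v assume "v \<le> k'" then show "q (v + a') - a \<le> k"
      using D(5)[of "v + a'"] by linarith
  next
    fix v w assume "v \<le> w" "w \<le> k'" then show "q (v + a') - a \<le> q (w + a') - a"
      using D(1) by (intro diff_le_mono) (simp add: order_preserving_def)
  qed
  have "res C (ordinal_map k' (a' + k') (\<lambda>v. v + a')) (res C (ordinal_map (a' + k') (a + k) q) A)
      = res C (ordinal_map k' (a + k) (\<lambda>v. q (v + a'))) A"
    using D A by (simp add: res_res)
  also have "ordinal_map k' (a + k) (\<lambda>v. q (v + a')) = ordinal_map k' (a + k) (\<lambda>v. (q (v + a') - a) + a)"
    using D(4) by simp
  also have "res C \<dots> A = res C (ordinal_map k' k (\<lambda>v. q (v + a') - a)) (res C (ordinal_map k (a + k) (\<lambda>v. v + a)) A)"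
    using r A by (subst res_res) simp_all
  also have "\<dots> = res C (ordinal_map k' (k' + b') (\<lambda>v. v))
       (res C (ordinal_map (k' + b') (k + b) (\<lambda>v. q (v + a') - a)) B)"
    unfolding eq using r B D by (simp add: res_res)
  finally show ?thesis
    using A B D by (simp add: composable_pairs_iff res_in_sec)
qed

end

section \<open>Compositions are natural\<close>

lemma preserves_overlap_identity:
  assumes q: "preserves_overlap a' k' b' a k b q" and l: "a' + k' + b' = a + k + b"
    and id: "\<And>v. v \<le> a + k + b \<Longrightarrow> q v = v"
  shows "a' = a" "k' = k" "b' = b"
proof -
  have 1: "a \<le> q a'" "q (a' + k') \<le> a + k" using q by (auto simp: preserves_overlap_def)
  obtain y where "a' \<le> y" "y \<le> a' + k'" "q y = a"
    using q unfolding preserves_overlap_def by (meson le_add1 order_refl)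
  moreover obtain z where "a' \<le> z" "z \<le> a' + k'" "q z = a + k"
    using q unfolding preserves_overlap_def by (meson le_add1 order_refl)
  ultimately show "a' = a" "k' = k" "b' = b"
    using id[of a'] id[of "a' + k'"] id[of y] id[of z] 1 l by auto
qed

lemma collapse_degen:
  fixes q :: "nat \<Rightarrow> nat"
  assumes "q i = q (Suc i)"
  shows "(if (if v \<le> i then v else v - 1) \<le> i then q (if v \<le> i then v else v - 1)
          else q (Suc (if v \<le> i then v else v - 1))) = q v"
proof (cases "v \<le> Suc i")
  case True
  then show ?thesis using assms by (cases "v = Suc i") auto
next
  case False
  then show ?thesis by (cases v) auto
qed

text \<open>If \<open>q\<close> identifies \<open>i\<close> and \<open>i + 1\<close>, it factors through the degeneracy at \<open>i\<close>. The point that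
  disappears is taken from the left part, the overlap or the right part, according to the position of
  \<open>i\<close>; the indices \<open>(a1, k1, b1)\<close> record the result in all three cases.\<close>

lemma preserves_overlap_collapse:
  assumes q: "preserves_overlap a' k' b' a k b q" and i: "i < a' + k' + b'" and eq: "q i = q (Suc i)"
    and l: "a' + k' + b' = Suc (a1 + k1 + b1)"
    and a: "a1 = (if i < a' then a' - 1 else a')"
    and ak: "a1 + k1 = (if i < a' + k' then a' + k' - 1 else a' + k')"
  shows "preserves_overlap a1 k1 b1 a k b (\<lambda>v. if v \<le> i then q v else q (Suc v))"
proof -
  note D = preserves_overlapD[OF q]
  let ?q = "\<lambda>v. if v \<le> i then q v else q (Suc v)"
  have "order_preserving (a1 + k1 + b1) (a + k + b) ?q"
    using D(1) l unfolding order_preserving_def by auto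
  moreover have "?q (a1 + k1) \<le> a + k"
  proof (cases "i < a' + k'")
    case True
    then have "Suc (a1 + k1) \<le> a' + k'" using ak by auto
    then show ?thesis using D(5) by simp
  next
    case False
    then show ?thesis using D(5) ak by auto
  qed
  moreover have "a \<le> ?q a1"
  proof (cases "i < a'")
    case True
    then have "Suc a1 = a'" "i \<le> a1" using a by auto
    then show ?thesis using D(4)[of a'] eq by (cases "a1 = i") auto
  next
    case False
    then show ?thesis using D(4)[of a'] a by auto
  qed
  moreover have "\<exists>z. a1 \<le> z \<and> z \<le> a1 + k1 \<and> ?q z = x" if x: "a \<le> x" "x \<le> a + k" for x
  proof -
    obtain y where y: "a' \<le> y" "y \<le> a' + k'" "q y = x"
      using q x unfolding preserves_overlap_def by blast
    show ?thesis
    proof (cases "y \<le> i")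
      case True
      then show ?thesis using y a ak by (intro exI[of _ y]) (auto split: if_splits)
    next
      case False
      moreover have "?q (y - 1) = x"
        using False y eq by (cases "y = Suc i") auto
      ultimately show ?thesis using y a ak
        by (intro exI[of _ "y - 1"]) (auto split: if_splits)
    qed
  qed
  ultimately show ?thesis unfolding preserves_overlap_def by blast
qed

text \<open>If \<open>q\<close> misses \<open>x\<close>, it factors through the face at \<open>x\<close>. Points of the overlap are hit, so \<open>x\<close> lies
  to the left or to the right of the overlap and shortens \<open>a\<close> or \<open>b\<close>.\<close>

lemma preserves_overlap_avoid:
  assumes q: "preserves_overlap a' k' b' a k b q" and x: "x \<le> a + k + b"
    and avoid: "\<And>v. v \<le> a' + k' + b' \<Longrightarrow> q v \<noteq> x"
    and l: "a + k + b = Suc (a1 + k + b1)" and a: "a1 = (if x < a then a - 1 else a)"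
  shows "preserves_overlap a' k' b' a1 k b1 (\<lambda>v. if q v < x then q v else q v - 1)"
proof -
  note D = preserves_overlapD[OF q]
  let ?q = "\<lambda>v. if q v < x then q v else q v - 1"
  have ov: "\<exists>y. a' \<le> y \<and> y \<le> a' + k' \<and> q y = z" if "a \<le> z" "z \<le> a + k" for z
    using q that unfolding preserves_overlap_def by blast
  have out: "x < a \<or> a + k < x"
  proof (rule ccontr)
    assume "\<not> ?thesis"
    then obtain y where "y \<le> a' + k'" "q y = x" using ov[of x] by auto
    then show False using avoid[of y] by simp
  qed
  have bd: "\<And>v. v \<le> a' + k' + b' \<Longrightarrow> q v \<le> a + k + b"
    and mo: "\<And>v w. v \<le> w \<Longrightarrow> w \<le> a' + k' + b' \<Longrightarrow> q v \<le> q w"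
    using D(1) by (auto simp: order_preserving_def)
  have "order_preserving (a' + k' + b') (a1 + k + b1) ?q"
    unfolding order_preserving_def
  proof (intro conjI allI impI)
    fix v assume v: "v \<le> a' + k' + b'"
    show "?q v \<le> a1 + k + b1" using bd[OF v] x l by auto
  next
    fix v w assume "v \<le> w" "w \<le> a' + k' + b'"
    then show "?q v \<le> ?q w" using mo[of v w] by auto
  qed
  moreover have "?q (a' + k') \<le> a1 + k"
    using D(5)[of "a' + k'"] D(4)[of "a' + k'"] out a by auto
  moreover have "a1 \<le> ?q a'"
    using D(4)[of a'] avoid[of a'] out a by auto
  moreover have "\<exists>y. a' \<le> y \<and> y \<le> a' + k' \<and> ?q y = z" if z: "a1 \<le> z" "z \<le> a1 + k" for z
  proof (cases "x < a")
    case True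
    then obtain y where "a' \<le> y" "y \<le> a' + k'" "q y = Suc z"
    proof -
      have "a \<le> Suc z" "Suc z \<le> a + k" using True a z by auto
      then show thesis using ov that by blast
    qed
    then show ?thesis using True a z by (intro exI[of _ y]) auto
  next
    case False
    then obtain y where "a' \<le> y" "y \<le> a' + k'" "q y = z"
      using ov[of z] a z by auto
    then show ?thesis using False a z out by (intro exI[of _ y]) auto
  qed
  ultimately show ?thesis unfolding preserves_overlap_def by blast
qed

lemma (in compository) comp_in_sec:
  assumes "(A, B) \<in> composable_pairs C k (a + k) (k + b)"
  shows "comp (k, a + k, k + b) (A, B) \<in> sec C (a + k + b)"
proof -
  have "comp (k, a + k, k + b) \<in> composable_pairs C k (a + k) (k + b) \<rightarrow>\<^sub>E sec C (a + k + (k + b) - k)"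
    using PiE_mem[OF comp_in, of "(k, a + k, k + b)"] by simp
  from PiE_mem[OF this assms] show ?thesis by (simp add: add.assoc)
qed

text \<open>The laws for faces and degeneracies generate naturality along all maps that preserve the overlap.
  The induction is on the sum of the dimensions of source and target: splitting off a degeneracy
  lowers the dimension of the source, splitting off a face that of the target.\<close>

lemma (in compository) comp_natural:
  assumes "preserves_overlap a' k' b' a k b q" "(A, B) \<in> composable_pairs C k (a + k) (k + b)"
  shows "res C (ordinal_map (a' + k' + b') (a + k + b) q) (comp (k, a + k, k + b) (A, B))
          = comp (k', a' + k', k' + b')
              (res C (ordinal_map (a' + k') (a + k) q) A,
               res C (ordinal_map (k' + b') (k + b) (\<lambda>v. q (v + a') - a)) B)"
  using assms
proof (induction "a' + k' + b' + (a + k + b)" arbitrary: a' k' b' a k b q A B rule: less_induct)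
  case less
  note C = simplicial_set
  note q = less.prems(1) and AB = less.prems(2)
  note D = preserves_overlapD[OF q]
  have A: "A \<in> sec C (a + k)" and B: "B \<in> sec C (k + b)"
    using AB by (simp_all add: composable_pairs_iff[OF C])
  consider (collapse) i where "i < a' + k' + b'" "q i = q (Suc i)"
    | (avoid) x where "x \<le> a + k + b" "\<And>v. v \<le> a' + k' + b' \<Longrightarrow> q v \<noteq> x"
    | (bij) "\<And>v. v < a' + k' + b' \<Longrightarrow> q v \<noteq> q (Suc v)" "\<And>x. x \<le> a + k + b \<Longrightarrow> \<exists>v\<le>a' + k' + b'. q v = x"
    by blast
  then show ?case
  proof cases
    case bij
    note id = surjective_strict_is_identity[OF D(1) bij]
    note e = preserves_overlap_identity[OF q id(1)]
    have "q v = v" if "v \<le> a + k + b" for v using id that by simp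
    then show ?thesis
      using e(1,2,3) A B comp_in_sec[OF AB] id by (simp add: res_id[OF C])
  next
    case (collapse i)
    define q' where "q' = (\<lambda>v. if v \<le> i then q v else q (Suc v))"
    define d where "d = (\<lambda>i v. if v \<le> i then v else v - 1 :: nat)"
    have qd: "q' (d i v) = q v" for v
      using collapse_degen[OF collapse(2), of v] by (simp add: q'_def d_def)
    have deg: "degen j n = ordinal_map (Suc n) n (d j)" for j n
      by (simp add: degen_eq d_def)
    have d_shift: "d i (v + a') = d (i - a') v + a'" if "a' \<le> i" for v
      using that by (auto simp: d_def)
    have opd: "order_preserving (Suc n) n (d j)" if "j \<le> n" for j n
      using that by (auto simp: order_preserving_def d_def)
    let ?comp = "comp (k, a + k, k + b) (A, B)"
    \<comment> \<open>The points \<open>i\<close> and \<open>i + 1\<close> span a unit step before the overlap, inside it or after it, and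
      each of the three degeneracy laws handles one of these.\<close>
    consider "i < a'" | "a' \<le> i" "i < a' + k'" | "a' + k' \<le> i" by linarith
    then show ?thesis
    proof cases
      case 1
      then obtain a1 where a1: "a' = Suc a1" by (cases a') auto
      have q': "preserves_overlap a1 k' b' a k b q'"
        unfolding q'_def by (rule preserves_overlap_collapse[OF q collapse]) (use 1 a1 in auto)
      note D' = preserves_overlapD[OF q']
      let ?A = "res C (ordinal_map (a1 + k') (a + k) q') A"
      let ?B = "res C (ordinal_map (k' + b') (k + b) (\<lambda>v. q' (v + a1) - a)) B"
      have AB': "(?A, ?B) \<in> composable_pairs C k' (a1 + k') (k' + b')"
        by (rule composable_restrict[OF C q' AB])
      have "res C (ordinal_map (a' + k' + b') (a + k + b) q) ?comp
        = res C (degen i (a1 + k' + b')) (res C (ordinal_map (a1 + k' + b') (a + k + b) q') ?comp)"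
        unfolding deg using 1 a1 opd[of i "a1 + k' + b'"] comp_in_sec[OF AB] D'(1)
        by (subst res_res[OF C]) (simp_all add: qd)
      also have "\<dots> = res C (degen i (a1 + k' + b')) (comp (k', a1 + k', k' + b') (?A, ?B))"
        by (subst less.hyps[OF _ q' AB]) (simp_all add: a1)
      also have "\<dots> = comp (k', a' + k', k' + b') (res C (degen i (a1 + k')) ?A, ?B)"
        using degeneracy_left[OF AB', of i] 1 a1 by (simp add: add.assoc)
      also have "res C (degen i (a1 + k')) ?A = res C (ordinal_map (a' + k') (a + k) q) A"
        unfolding deg using 1 a1 opd[of i "a1 + k'"] A D'(2)
        by (subst res_res[OF C]) (simp_all add: qd)
      also have "ordinal_map (k' + b') (k + b) (\<lambda>v. q' (v + a1) - a)
          = ordinal_map (k' + b') (k + b) (\<lambda>v. q (v + a') - a)"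
      proof -
        have "q' (v + a1) = q (v + a')" for v
        proof (cases "v + a1 \<le> i")
          case True
          then have "v = 0" "i = a1" using 1 a1 by auto
          then show ?thesis using collapse(2) a1 by (simp add: q'_def)
        qed (simp add: q'_def a1)
        then show ?thesis by simp
      qed
      finally show ?thesis .
    next
      case 2
      then obtain k1 where k1: "k' = Suc k1" by (cases k') auto
      have q': "preserves_overlap a' k1 b' a k b q'"
        unfolding q'_def by (rule preserves_overlap_collapse[OF q collapse]) (use 2 k1 in auto)
      note D' = preserves_overlapD[OF q']
      let ?A = "res C (ordinal_map (a' + k1) (a + k) q') A"
      let ?B = "res C (ordinal_map (k1 + b') (k + b) (\<lambda>v. q' (v + a') - a)) B"
      have AB': "(?A, ?B) \<in> composable_pairs C k1 (a' + k1) (k1 + b')"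
        by (rule composable_restrict[OF C q' AB])
      have "res C (ordinal_map (a' + k' + b') (a + k + b) q) ?comp
        = res C (degen i (a' + k1 + b')) (res C (ordinal_map (a' + k1 + b') (a + k + b) q') ?comp)"
        unfolding deg using 2 k1 opd[of i "a' + k1 + b'"] comp_in_sec[OF AB] D'(1)
        by (subst res_res[OF C]) (simp_all add: qd)
      also have "\<dots> = res C (degen i (a' + k1 + b')) (comp (k1, a' + k1, k1 + b') (?A, ?B))"
        by (subst less.hyps[OF _ q' AB]) (simp_all add: k1)
      also have "\<dots> = comp (k', a' + k', k' + b') (res C (degen i (a' + k1)) ?A, res C (degen (i - a') (k1 + b')) ?B)"
        using degeneracy_middle[OF AB', of i] 2 k1 by (simp add: add.assoc)
      also have "res C (degen i (a' + k1)) ?A = res C (ordinal_map (a' + k') (a + k) q) A"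
        unfolding deg using 2 k1 opd[of i "a' + k1"] A D'(2)
        by (subst res_res[OF C]) (simp_all add: qd)
      also have "res C (degen (i - a') (k1 + b')) ?B
          = res C (ordinal_map (k' + b') (k + b) (\<lambda>v. q (v + a') - a)) B"
        unfolding deg using 2 k1 opd[of "i - a'" "k1 + b'"] B D'(3)
        by (subst res_res[OF C]) (simp_all add: qd flip: d_shift)
      finally show ?thesis .
    next
      case 3
      then obtain b1 where b1: "b' = Suc b1" using collapse(1) by (cases b') auto
      have q': "preserves_overlap a' k' b1 a k b q'"
        unfolding q'_def by (rule preserves_overlap_collapse[OF q collapse]) (use 3 b1 in auto)
      note D' = preserves_overlapD[OF q']
      let ?A = "res C (ordinal_map (a' + k') (a + k) q') A"
      let ?B = "res C (ordinal_map (k' + b1) (k + b) (\<lambda>v. q' (v + a') - a)) B"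
      have AB': "(?A, ?B) \<in> composable_pairs C k' (a' + k') (k' + b1)"
        by (rule composable_restrict[OF C q' AB])
      have "res C (ordinal_map (a' + k' + b') (a + k + b) q) ?comp
        = res C (degen i (a' + k' + b1)) (res C (ordinal_map (a' + k' + b1) (a + k + b) q') ?comp)"
        unfolding deg using collapse(1) b1 opd[of i "a' + k' + b1"] comp_in_sec[OF AB] D'(1)
        by (subst res_res[OF C]) (simp_all add: qd)
      also have "\<dots> = res C (degen i (a' + k' + b1)) (comp (k', a' + k', k' + b1) (?A, ?B))"
        by (subst less.hyps[OF _ q' AB]) (simp_all add: b1)
      also have "\<dots> = comp (k', a' + k', k' + b') (?A, res C (degen (i - a') (k' + b1)) ?B)"
        using degeneracy_right[OF AB', of i] 3 b1 collapse(1) by (simp add: add.assoc)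
      also have "ordinal_map (a' + k') (a + k) q' = ordinal_map (a' + k') (a + k) q"
        using 3 by (simp add: q'_def)
      also have "res C (degen (i - a') (k' + b1)) ?B
          = res C (ordinal_map (k' + b') (k + b) (\<lambda>v. q (v + a') - a)) B"
        unfolding deg using 3 b1 collapse(1) opd[of "i - a'" "k' + b1"] B D'(3)
        by (subst res_res[OF C]) (simp_all add: qd flip: d_shift)
      finally show ?thesis .
    qed
  next
    case (avoid x)
    define q' where "q' = (\<lambda>v. if q v < x then q v else q v - 1)"
    define f where "f = (\<lambda>x v. if v < x then v else v + 1 :: nat)"
    have qf: "f x (q' v) = q v" if "v \<le> a' + k' + b'" for v
      using avoid(2)[OF that] by (auto simp: q'_def f_def)
    have fac: "face j (Suc n) = ordinal_map n (Suc n) (f j)" for j n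
      by (simp add: face_eq f_def)
    have opf: "order_preserving n (Suc n) (f j)" for j n
      by (auto simp: order_preserving_def f_def)
    let ?comp = "comp (k, a + k, k + b) (A, B)"
    have "x < a \<or> a + k < x"
    proof (rule ccontr)
      assume "\<not> ?thesis"
      then obtain y where "y \<le> a' + k'" "q y = x"
        using q unfolding preserves_overlap_def by (meson not_le)
      then show False using avoid(2)[of y] by simp
    qed
    then show ?thesis
    proof
      assume x: "x < a"
      then obtain a1 where a1: "a = Suc a1" by (cases a) auto
      have q': "preserves_overlap a' k' b' a1 k b q'"
        unfolding q'_def by (rule preserves_overlap_avoid[OF q avoid]) (use x a1 in auto)
      note D' = preserves_overlapD[OF q']
      have fp: "preserves_overlap a1 k b a k b (f x)"
        unfolding f_def a1 using x a1 by (intro preserves_overlap_face_left) simp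
      let ?A = "res C (face x (a + k)) A"
      have right: "res C (ordinal_map (k + b) (k + b) (\<lambda>v. f x (v + a1) - a)) B = B"
        using x a1 B by (intro res_id[OF C]) (auto simp: f_def)
      have AB': "(?A, B) \<in> composable_pairs C k (a1 + k) (k + b)"
        using composable_restrict[OF C fp AB] right by (simp add: fac a1)
      have "res C (ordinal_map (a' + k' + b') (a + k + b) q) ?comp
        = res C (ordinal_map (a' + k' + b') (a1 + k + b) q') (res C (face x (a + k + b)) ?comp)"
        using opf[of "a1 + k + b"] comp_in_sec[OF AB] D'(1) a1 qf fac
        by (simp add: res_res[OF C] cong: ordinal_map_cong)
      also have "res C (face x (a + k + b)) ?comp = comp (k, a1 + k, k + b) (?A, B)"
        using face_left[OF AB, of x] x a1 by (simp add: add.assoc)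
      also have "res C (ordinal_map (a' + k' + b') (a1 + k + b) q') \<dots>
         = comp (k', a' + k', k' + b')
              (res C (ordinal_map (a' + k') (a1 + k) q') ?A,
               res C (ordinal_map (k' + b') (k + b) (\<lambda>v. q' (v + a') - a1)) B)"
        by (rule less.hyps[OF _ q' AB']) (simp add: a1)
      also have "res C (ordinal_map (a' + k') (a1 + k) q') ?A = res C (ordinal_map (a' + k') (a + k) q) A"
        using opf[of "a1 + k"] A D'(2) a1 qf fac
        by (simp add: res_res[OF C] cong: ordinal_map_cong)
      also have "ordinal_map (k' + b') (k + b) (\<lambda>v. q' (v + a') - a1)
           = ordinal_map (k' + b') (k + b) (\<lambda>v. q (v + a') - a)"
      proof -
        have "q' (v + a') - a1 = q (v + a') - a" if "v \<le> k' + b'" for v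
          using D(4)[of "v + a'"] that x a1 by (auto simp: q'_def)
        then show ?thesis by simp
      qed
      finally show ?thesis .
    next
      assume x: "a + k < x"
      then obtain b1 where b1: "b = Suc b1" using avoid(1) by (cases b) auto
      have q': "preserves_overlap a' k' b' a k b1 q'"
        unfolding q'_def by (rule preserves_overlap_avoid[OF q avoid]) (use x b1 in auto)
      note D' = preserves_overlapD[OF q']
      have fp: "preserves_overlap a k b1 a k b (f x)"
        unfolding f_def b1 using x by (intro preserves_overlap_face_right)
      have f_shift: "f x (v + a) - a = f (x - a) v" for v
        using x by (auto simp: f_def)
      let ?B = "res C (face (x - a) (k + b)) B"
      have left: "res C (ordinal_map (a + k) (a + k) (f x)) A = A"
        using x A by (intro res_id[OF C]) (auto simp: f_def)
      have AB': "(A, ?B) \<in> composable_pairs C k (a + k) (k + b1)"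
        using composable_restrict[OF C fp AB] left by (simp add: fac b1 f_shift)
      have "res C (ordinal_map (a' + k' + b') (a + k + b) q) ?comp
        = res C (ordinal_map (a' + k' + b') (a + k + b1) q') (res C (face x (a + k + b)) ?comp)"
        using opf[of "a + k + b1"] comp_in_sec[OF AB] D'(1) b1 qf fac
        by (simp add: res_res[OF C] cong: ordinal_map_cong)
      also have "res C (face x (a + k + b)) ?comp = comp (k, a + k, k + b1) (A, ?B)"
        using face_right[OF AB, of x] x b1 avoid(1) by (simp add: add.assoc)
      also have "res C (ordinal_map (a' + k' + b') (a + k + b1) q') \<dots>
         = comp (k', a' + k', k' + b')
              (res C (ordinal_map (a' + k') (a + k) q') A,
               res C (ordinal_map (k' + b') (k + b1) (\<lambda>v. q' (v + a') - a)) ?B)"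
        by (rule less.hyps[OF _ q' AB']) (simp add: b1)
      also have "ordinal_map (a' + k') (a + k) q' = ordinal_map (a' + k') (a + k) q"
      proof -
        have "q' v = q v" if "v \<le> a' + k'" for v
          using D(5)[OF that] x by (auto simp: q'_def)
        then show ?thesis by simp
      qed
      also have "res C (ordinal_map (k' + b') (k + b1) (\<lambda>v. q' (v + a') - a)) ?B
          = res C (ordinal_map (k' + b') (k + b) (\<lambda>v. q (v + a') - a)) B"
      proof -
        have "f (x - a) (q' (v + a') - a) = q (v + a') - a" if "v \<le> k' + b'" for v
          using D'(4)[of "v + a'"] qf[of "v + a'"] that by (simp flip: f_shift)
        then show ?thesis
          using opf[of "k + b1"] B D'(3) b1 fac
          by (simp add: res_res[OF C] cong: ordinal_map_cong)
      qed
      finally show ?thesis .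
    qed
  qed
qed

section \<open>The compository of a gleaf\<close>

lemma composition_of_gluing_apply:
  "composition_of_gluing glue (k, a + k, k + b) = glue (s (a + k) (a + k + b), t (k + b) (a + k + b))"
  by (simp add: composition_of_gluing_def add.assoc)

text \<open>Faces and degeneracies are partial naturality for the five families of maps above. Restricting a
  composite to its factors is partial naturality along the inclusions of the two segments together
  with the identity law; it is needed because the back-and-forth law of a gleaf restricts a glued
  section to both legs, while that of a compository keeps one of the two factors.\<close>

lemma compository_of_gleaf:
  fixes C :: "'x sset"
  assumes "gleaf Delta Delta_bicoverings C glue"
  shows "compository C (composition_of_gluing glue)"
proof -
  interpret G: gleaf Delta Delta_bicoverings C glue by fact
  have C: "simplicial_set C" by unfold_locales
  let ?c = "composition_of_gluing glue"
  note c_apply = composition_of_gluing_apply[of glue]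
  have natural: "res C (ordinal_map (a' + k' + b') (a + k + b) q) (?c (k, a + k, k + b) (A, B))
          = ?c (k', a' + k', k' + b')
              (res C (ordinal_map (a' + k') (a + k) q) A,
               res C (ordinal_map (k' + b') (k + b) (\<lambda>v. q (v + a') - a)) B)"
    if "preserves_overlap a' k' b' a k b q" "(A, B) \<in> composable_pairs C k (a + k) (k + b)"
    for a' k' b' a k b q A B
    unfolding c_apply
    by (rule G.partial_naturality[OF initial_final_bicovering initial_final_bicovering
          bicovering_morphism_of_map[OF that(1)]])
      (simp add: fibre_product_s_t[OF C] that(2))
  have id_left: "?c (k, k, k + b) (res C (s k (k + b)) A, A) = A" if A: "A \<in> sec C (k + b)" for k b A
  proof -
    have "(res C (s k (k + b)) A, A) \<in> composable_pairs C k (0 + k) (k + b)"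
      using A unfolding composable_pairs_iff[OF C]
      by (simp add: s_eq res_in_sec[OF C] res_id[OF C])
    then have fp: "(res C (s k (k + b)) A, A) \<in> fibre_product Delta C (s (0 + k) (0 + k + b)) (Ident Delta (k + b))"
      unfolding fibre_product_s_t[OF C, symmetric] by (simp add: t_eq Ident_eq)
    have "(s (0 + k) (0 + k + b), Ident Delta (k + b)) \<in> Delta_bicoverings"
      using initial_final_bicovering[of 0 k b] by (simp add: t_eq Ident_eq)
    from G.identity_right[OF this fp] show ?thesis
      using c_apply[of k 0 b] by (simp add: t_eq Ident_eq)
  qed
  have id_right: "?c (k, a + k, k) (A, res C (t k (a + k)) A) = A" if A: "A \<in> sec C (a + k)" for k a A
  proof -
    have "(A, res C (t k (a + k)) A) \<in> composable_pairs C k (a + k) (k + 0)"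
      using A unfolding composable_pairs_iff[OF C]
      by (simp add: t_eq res_in_sec[OF C] res_id[OF C])
    then have fp: "(A, res C (t k (a + k)) A) \<in> fibre_product Delta C (Ident Delta (a + k)) (t (k + 0) (a + k + 0))"
      unfolding fibre_product_s_t[OF C, symmetric] by (simp add: s_eq Ident_eq)
    have "(Ident Delta (a + k), t (k + 0) (a + k + 0)) \<in> Delta_bicoverings"
      using initial_final_bicovering[of a k 0] by (simp add: s_eq Ident_eq)
    from G.identity_left[OF this fp] show ?thesis
      using c_apply[of k a 0] by (simp add: s_eq Ident_eq)
  qed
  have final: "res C (t (k + b) (a + k + b)) (?c (k, a + k, k + b) (A, B)) = B"
    and initial: "res C (s (a + k) (a + k + b)) (?c (k, a + k, k + b) (A, B)) = A"
    if AB: "(A, B) \<in> composable_pairs C k (a + k) (k + b)" for a k b A B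
  proof -
    have A: "A \<in> sec C (a + k)" and B: "B \<in> sec C (k + b)"
      and eq: "res C (ordinal_map k (a + k) (\<lambda>v. v + a)) A = res C (ordinal_map k (k + b) (\<lambda>v. v)) B"
      using AB by (simp_all add: composable_pairs_iff[OF C])
    show "res C (t (k + b) (a + k + b)) (?c (k, a + k, k + b) (A, B)) = B"
      using natural[OF preserves_overlap_final AB] eq id_left[OF B] B by (simp add: t_eq s_eq res_id[OF C])
    have po: "preserves_overlap a k 0 a k b (\<lambda>v. v)"
      unfolding preserves_overlap_def by auto
    show "res C (s (a + k) (a + k + b)) (?c (k, a + k, k + b) (A, B)) = A"
      using natural[OF po AB] eq[symmetric] id_right[OF A] A by (simp add: t_eq s_eq res_id[OF C])
  qed
  show ?thesis
  proof (rule compository.intro)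
    show "simplicial_set C" by (rule C)
    show "?c \<in> (\<Pi>\<^sub>E (k, m, n) \<in> {(k, m, n). k \<le> m \<and> k \<le> n}.
                 composable_pairs C k m n \<rightarrow>\<^sub>E sec C (m + n - k))"
    proof (rule PiE_I)
      fix x :: "nat \<times> nat \<times> nat" assume "x \<in> {(k, m, n). k \<le> m \<and> k \<le> n}"
      then obtain k a b where x: "x = (k, a + k, k + b)"
        by (auto elim!: overlap_indices)
      have "glue (s (a + k) (a + k + b), t (k + b) (a + k + b))
          \<in> fibre_product Delta C (s (a + k) (a + k + b)) (t (k + b) (a + k + b)) \<rightarrow>\<^sub>E sec C (a + k + b)"
        using PiE_mem[OF G.glue_in initial_final_bicovering[of a k b]] by simp
      then show "?c x \<in> (case x of (k, m, n) \<Rightarrow> composable_pairs C k m n \<rightarrow>\<^sub>E sec C (m + n - k))"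
        unfolding fibre_product_s_t[OF C] x c_apply by (simp add: add.assoc)
    qed (simp add: composition_of_gluing_def restrict_def)
  next
    fix A k m assume "A \<in> sec C m" "k \<le> m"
    then show "?c (k, k, m) (res C (s k m) A, A) = A"
      using id_left[of A k "m - k"] by simp
  next
    fix A k m assume "A \<in> sec C m" "k \<le> m"
    then show "?c (k, m, k) (A, res C (t k m) A) = A"
      using id_right[of A "m - k" k] by simp
  next
    fix A B k m n i assume AB: "(A, B) \<in> composable_pairs C k m n" and i: "i \<le> n - k"
    then obtain a b where ab: "m = a + k" "n = k + b" "m + n - k = a + k + b"
      by (auto simp: composable_pairs_def elim: overlap_indices)
    note AB = AB[unfolded ab]
    obtain b' where b: "b = i + b'" using i ab by (metis add_diff_cancel_left' le_Suc_ex)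
    let ?f = "s (a + (k + i)) (a + (k + i) + b')" and ?g = "t (k + i + b') (a + (k + i) + b')"
      and ?h = "s (a + k) (a + k + i)"
    have j: "a + (k + i) + b' = a + k + b" "k + i + b' = k + b" by (simp_all add: b)
    have h: "s (a + (k + i)) (a + k + b) \<cdot>\<^bsub>Delta\<^esub> ?h = s (a + k) (a + k + b)"
      by (simp add: s_eq b add.assoc)
    have J: "(?h, t (k + i) (a + (k + i))) \<in> Delta_bicoverings"
      using initial_final_bicovering[of a k i] by (simp add: add.assoc)
    let ?X = "glue (s (a + k) (a + k + b), t (k + b) (a + k + b)) (A, B)"
    have "glue (?f, ?g) (res C ?f ?X, res C ?g ?X) = ?X"
      using G.back_and_forth[OF initial_final_bicovering pullback_s_t J, of b' A B]
        AB initial_final_bicovering[of a k b] unfolding j h fibre_product_s_t[OF C] by simp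
    moreover have "res C ?g ?X = B"
      using final[OF AB] unfolding c_apply j .
    ultimately have "?c (k + i, a + (k + i), k + i + b') (res C ?f ?X, B) = ?X"
      by (simp only: c_apply[of "k + i" a b'])
    then show "?c (k + i, m + i, n) (res C (s (m + i) (m + n - k)) (?c (k, m, n) (A, B)), B) = ?c (k, m, n) (A, B)"
      unfolding ab(3) unfolding ab(1,2) c_apply[of k a b] by (simp add: b add.assoc)
  next
    fix A B k m n i assume AB: "(A, B) \<in> composable_pairs C k m n" and i: "i \<le> m - k"
    then obtain a b where ab: "m = a + k" "n = k + b" "m + n - k = a + k + b"
      by (auto simp: composable_pairs_def elim: overlap_indices)
    note AB = AB[unfolded ab]
    obtain a' where a: "a = a' + i" using i ab by (metis add.commute add_diff_cancel_right' le_Suc_ex)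
    let ?f = "t (i + k + b) (a' + (i + k) + b)" and ?g = "s (a' + (i + k)) (a' + (i + k) + b)"
      and ?h = "t (k + b) (i + k + b)"
    have j: "a' + (i + k) + b = a + k + b" "a' + (i + k) = a + k" by (simp_all add: a)
    have h: "t (i + k + b) (a + k + b) \<cdot>\<^bsub>Delta\<^esub> ?h = t (k + b) (a + k + b)"
      by (simp add: t_eq a add.assoc)
    have J: "(?h, s (i + k) (i + k + b)) \<in> Delta_bicoverings"
      by (rule final_initial_bicovering)
    have fp: "(B, A) \<in> fibre_product Delta C (t (k + b) (a + k + b)) (s (a + k) (a + k + b))"
      using AB by (simp add: fibre_product_swap fibre_product_s_t[OF C])
    let ?X = "glue (s (a + k) (a + k + b), t (k + b) (a + k + b)) (A, B)"
    have X: "glue (t (k + b) (a + k + b), s (a + k) (a + k + b)) (B, A) = ?X"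
      using AB by (intro G.glue_swap initial_final_bicovering) (simp add: fibre_product_s_t[OF C])
    have init: "res C (s (a + k) (a + k + b)) ?X = A"
      using initial[OF AB] by (simp add: c_apply)
    have main: "glue (?f, ?g) (res C ?f ?X, A) = ?X"
      using G.back_and_forth[OF final_initial_bicovering is_pullback_swap[OF pullback_s_t] J, of a' B A]
        fp final_initial_bicovering[of k b a] unfolding j h X init by simp
    have Xs: "?X \<in> sec C (a + k + b)"
      using PiE_mem[OF PiE_mem[OF G.glue_in initial_final_bicovering[of a k b], unfolded prod.case], of "(A, B)"]
        AB by (simp add: fibre_product_s_t[OF C])
    have "(A, res C ?f ?X) \<in> composable_pairs C (i + k) (a' + (i + k)) (i + k + b)"
    proof -
      have "res C (t (i + k) (a' + (i + k))) A = res C (t (i + k) (a' + (i + k))) (res C (s (a + k) (a + k + b)) ?X)"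
        by (simp only: init)
      also have "\<dots> = res C (s (i + k) (i + k + b)) (res C ?f ?X)"
        using Xs unfolding s_eq t_eq j by (simp add: res_res[OF C] a add.assoc)
      finally show ?thesis
        using AB Xs by (simp add: composable_pairs_def a t_eq res_in_sec[OF C] add.assoc)
    qed
    then have "(A, res C ?f ?X) \<in> fibre_product Delta C ?g ?f"
      unfolding fibre_product_s_t[OF C] .
    from G.glue_swap[OF initial_final_bicovering this]
    have "glue (?g, ?f) (A, res C ?f ?X) = ?X"
      unfolding main by (rule sym)
    then have "?c (i + k, a' + (i + k), i + k + b) (A, res C ?f ?X) = ?X"
      by (simp only: c_apply[of "i + k" a' b])
    then show "?c (k + i, m, n + i) (A, res C (t (n + i) (m + n - k)) (?c (k, m, n) (A, B))) = ?c (k, m, n) (A, B)"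
      unfolding ab(3) unfolding ab(1,2) c_apply[of k a b] by (simp add: a add_ac)
  next
    fix A B k m n i assume AB: "(A, B) \<in> composable_pairs C k m n" and i: "i \<le> m - k"
    then obtain a b where ab: "m = a + k" "n = k + b" "m + n - k = a + k + b"
      by (auto simp: composable_pairs_def elim: overlap_indices)
    note AB = AB[unfolded ab]
    have "i \<le> a" using i ab by simp
    note N = natural[OF preserves_overlap_degen_left[OF this] AB]
    have r: "res C (ordinal_map (k + b) (k + b) (\<lambda>v. (if v + Suc a \<le> i then v + Suc a else v + Suc a - 1) - a)) B = B"
      using AB \<open>i \<le> a\<close> by (intro res_id[OF C]) (auto simp: composable_pairs_def)
    show "res C (degen i (m + n - k)) (?c (k, m, n) (A, B)) = ?c (k, m + 1, n) (res C (degen i m) A, B)"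
      using N[unfolded r] unfolding ab(3) unfolding ab(1,2) degen_eq by simp
  next
    fix A B k m n i assume AB: "(A, B) \<in> composable_pairs C k m n" and i: "m \<le> i" "i \<le> m + n - k"
    then obtain a b where ab: "m = a + k" "n = k + b" "m + n - k = a + k + b"
      by (auto simp: composable_pairs_def elim: overlap_indices)
    note AB = AB[unfolded ab]
    have i': "a + k \<le> i" "i \<le> a + k + b" using i ab by simp_all
    note N = natural[OF preserves_overlap_degen_right[OF i'] AB]
    have l: "res C (ordinal_map (a + k) (a + k) (\<lambda>v. if v \<le> i then v else v - 1)) A = A"
      using AB i' by (intro res_id[OF C]) (auto simp: composable_pairs_def)
    have r: "ordinal_map (k + Suc b) (k + b) (\<lambda>v. (if v + a \<le> i then v + a else v + a - 1) - a)
        = degen (i + k - (a + k)) (k + b)"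
      using i' unfolding degen_eq by auto
    show "res C (degen i (m + n - k)) (?c (k, m, n) (A, B)) = ?c (k, m, n + 1) (A, res C (degen (i + k - m) n) B)"
      using N[unfolded l r] unfolding ab(3) unfolding ab(1,2) degen_eq[of i] by simp
  next
    fix A B k m n i assume AB: "(A, B) \<in> composable_pairs C k m n" and i: "m - k \<le> i" "i \<le> m"
    then obtain a b where ab: "m = a + k" "n = k + b" "m + n - k = a + k + b"
      by (auto simp: composable_pairs_def elim: overlap_indices)
    note AB = AB[unfolded ab]
    have i': "a \<le> i" "i \<le> a + k" using i ab by simp_all
    note N = natural[OF preserves_overlap_degen_middle[OF i'] AB]
    have r: "ordinal_map (Suc k + b) (k + b) (\<lambda>v. (if v + a \<le> i then v + a else v + a - 1) - a)
        = degen (i + k - (a + k)) (k + b)"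
      using i' unfolding degen_eq by auto
    show "res C (degen i (m + n - k)) (?c (k, m, n) (A, B))
         = ?c (k + 1, m + 1, n + 1) (res C (degen i m) A, res C (degen (i + k - m) n) B)"
      using N[unfolded r] unfolding ab(3) unfolding ab(1,2) degen_eq[of i] by simp
  next
    fix A B k m n i assume AB: "(A, B) \<in> composable_pairs C k m n" and i: "i < m - k"
    then obtain a b where ab: "m = a + k" "n = k + b" "m + n - k = a + k + b"
      by (auto simp: composable_pairs_def elim: overlap_indices)
    then obtain a1 where a1: "a = Suc a1" using i by (cases a) auto
    note AB = AB[unfolded ab a1]
    have i': "i \<le> a1" using i ab a1 by simp
    note N = natural[OF preserves_overlap_face_left[OF i'] AB]
    have r: "res C (ordinal_map (k + b) (k + b) (\<lambda>v. (if v + a1 < i then v + a1 else v + a1 + 1) - Suc a1)) B = B"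
      using AB i' by (intro res_id[OF C]) (auto simp: composable_pairs_def)
    show "res C (face i (m + n - k)) (?c (k, m, n) (A, B)) = ?c (k, m - 1, n) (res C (face i m) A, B)"
      using N[unfolded r] unfolding ab(3) unfolding ab(1,2) a1 by (simp add: face_eq)
  next
    fix A B k m n i assume AB: "(A, B) \<in> composable_pairs C k m n" and i: "m < i" "i \<le> m + n - k"
    then obtain a b where ab: "m = a + k" "n = k + b" "m + n - k = a + k + b"
      by (auto simp: composable_pairs_def elim: overlap_indices)
    then obtain b1 where b1: "b = Suc b1" using i by (cases b) auto
    note AB = AB[unfolded ab b1]
    have i': "a + k < i" using i ab by simp
    note N = natural[OF preserves_overlap_face_right[OF i'] AB]
    have l: "res C (ordinal_map (a + k) (a + k) (\<lambda>v. if v < i then v else v + 1)) A = A"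
      using AB i' by (intro res_id[OF C]) (auto simp: composable_pairs_def)
    have r: "ordinal_map (k + b1) (k + Suc b1) (\<lambda>v. (if v + a < i then v + a else v + a + 1) - a)
        = face (i + k - (a + k)) (k + Suc b1)"
      using i' by (auto simp: face_eq)
    show "res C (face i (m + n - k)) (?c (k, m, n) (A, B)) = ?c (k, m, n - 1) (A, res C (face (i + k - m) n) B)"
      using N[unfolded l r] unfolding ab(3) unfolding ab(1,2) b1 by (simp add: face_eq)
  qed
qed

section \<open>The gleaf of a compository\<close>

text \<open>The two legs may come in either order. The only cospan that has both forms is \<open>[k] = [k] = [k]\<close>, for
  which composable pairs are diagonal, so the preference for the first form is harmless (see
  \<open>gluing_final_initial\<close>).\<close>

definition gluing_of_composition ::
    "'x sset \<Rightarrow> (nat \<times> nat \<times> nat \<Rightarrow> 'x \<times> 'x \<Rightarrow> 'x) \<Rightarrow> simplex_map \<times> simplex_map \<Rightarrow> 'x \<times> 'x \<Rightarrow> 'x" where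
  "gluing_of_composition C cmp =
     (\<lambda>(f, g) \<in> Delta_bicoverings. \<lambda>(A, B) \<in> fibre_product Delta C f g.
        let m = Dom Delta f; n = Dom Delta g; j = Cod Delta f
        in if f = s m j \<and> g = t n j then cmp (m + n - j, m, n) (A, B)
           else cmp (m + n - j, n, m) (B, A))"

context compository
begin

abbreviation "gluing \<equiv> gluing_of_composition C comp"

lemma initial_comp:
  assumes AB: "(A, B) \<in> composable_pairs C k (a + k) (k + b)"
  shows "res C (s (a + k) (a + k + b)) (comp (k, a + k, k + b) (A, B)) = A"
proof -
  have A: "A \<in> sec C (a + k)"
    and eq: "res C (ordinal_map k (k + b) (\<lambda>v. v)) B = res C (t k (a + k)) A"
    using AB by (simp_all add: composable_pairs_iff[OF simplicial_set] t_eq)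
  have "preserves_overlap a k 0 a k b (\<lambda>v. v)"
    unfolding preserves_overlap_def by auto
  from comp_natural[OF this AB] show ?thesis
    using identity_right[OF A, of k] A by (simp add: s_eq eq res_id[OF simplicial_set])
qed

lemma final_comp:
  assumes AB: "(A, B) \<in> composable_pairs C k (a + k) (k + b)"
  shows "res C (t (k + b) (a + k + b)) (comp (k, a + k, k + b) (A, B)) = B"
proof -
  have B: "B \<in> sec C (k + b)"
    and eq: "res C (ordinal_map k (a + k) (\<lambda>v. v + a)) A = res C (s k (k + b)) B"
    using AB by (simp_all add: composable_pairs_iff[OF simplicial_set] s_eq)
  from comp_natural[OF preserves_overlap_final AB] show ?thesis
    using identity_left[OF B, of k] B by (simp add: t_eq eq res_id[OF simplicial_set])
qed

lemma gluing_initial_final: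
  assumes "(A, B) \<in> composable_pairs C k (a + k) (k + b)"
  shows "gluing (s (a + k) (a + k + b), t (k + b) (a + k + b)) (A, B) = comp (k, a + k, k + b) (A, B)"
  using assms initial_final_bicovering[of a k b] 
  by (simp add: gluing_of_composition_def fibre_product_s_t[OF simplicial_set])

lemma gluing_final_initial:
  assumes AB: "(A, B) \<in> composable_pairs C k (a + k) (k + b)"
  shows "gluing (t (k + b) (a + k + b), s (a + k) (a + k + b)) (B, A) = comp (k, a + k, k + b) (A, B)"
proof -
  let ?c = "t (k + b) (a + k + b) = s (k + b) (a + k + b) \<and> s (a + k) (a + k + b) = t (a + k) (a + k + b)"
  have fp: "(B, A) \<in> fibre_product Delta C (t (k + b) (a + k + b)) (s (a + k) (a + k + b))"
    using AB by (simp add: fibre_product_t_s[OF simplicial_set])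
  have 1: "gluing (t (k + b) (a + k + b), s (a + k) (a + k + b)) (B, A)
      = (if ?c then comp (k, k + b, a + k) (B, A) else comp (k, a + k, k + b) (A, B))"
    using fp final_initial_bicovering[of k b a]
    by (simp add: gluing_of_composition_def Let_def)
  show ?thesis
  proof (cases ?c)
    case True
    then have "a = 0" "b = 0" by (auto simp: s_eq t_eq)
    then have "A = B"
      using AB composable_pairs_diagonal[OF simplicial_set] by simp
    then show ?thesis using \<open>a = 0\<close> \<open>b = 0\<close> 1 by simp
  qed (simp only: 1 if_False)
qed

lemma gluing_swap:
  assumes "(f, g) \<in> Delta_bicoverings" "(A, B) \<in> fibre_product Delta C f g"
  shows "gluing (g, f) (B, A) = gluing (f, g) (A, B)"
  using assms(1)
proof (cases rule: Delta_bicoveringsE)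
  case (initial_final a k b)
  then show ?thesis
    using assms(2) by (simp add: fibre_product_s_t[OF simplicial_set] gluing_initial_final gluing_final_initial)
next
  case (final_initial a k b)
  then have "(B, A) \<in> composable_pairs C k (a + k) (k + b)"
    using assms(2) by (simp add: fibre_product_t_s[OF simplicial_set])
  then show ?thesis
    using final_initial by (simp add: gluing_initial_final gluing_final_initial)
qed

lemma restrictions_composable:
  assumes "X \<in> sec C (a + k + b)"
  shows "(res C (s (a + k) (a + k + b)) X, res C (t (k + b) (a + k + b)) X) \<in> composable_pairs C k (a + k) (k + b)"
  using assms unfolding composable_pairs_iff[OF simplicial_set] s_eq t_eq
  by (simp add: res_in_sec[OF simplicial_set] res_res[OF simplicial_set])

text \<open>The back-and-forth laws, brought into the shape in which a gleaf states them: a composite over a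
  smaller initial segment is also the composite of its restrictions to a larger initial segment and
  to the same final segment.\<close>

lemma extend_initial:
  assumes AB: "(A, B) \<in> composable_pairs C k (a + k) (k + (i + b))"
  defines "X \<equiv> comp (k, a + k, k + (i + b)) (A, B)"
  shows "comp (k + i, a + (k + i), k + i + b)
      (res C (s (a + (k + i)) (a + (k + i) + b)) X, res C (t (k + i + b) (a + (k + i) + b)) X) = X"
proof -
  have "res C (t (k + i + b) (a + (k + i) + b)) X = B"
    using final_comp[OF AB] by (simp add: X_def add.assoc)
  then show ?thesis
    using back_and_forth_left[OF AB, of i] by (simp add: X_def add.assoc)
qed

lemma extend_final:
  assumes AB: "(A, B) \<in> composable_pairs C k (a + i + k) (k + b)"
  defines "X \<equiv> comp (k, a + i + k, k + b) (A, B)"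
  shows "comp (i + k, a + (i + k), i + k + b)
      (res C (s (a + (i + k)) (a + (i + k) + b)) X, res C (t (i + k + b) (a + (i + k) + b)) X) = X"
proof -
  have "res C (s (a + (i + k)) (a + (i + k) + b)) X = A"
    using initial_comp[OF AB] by (simp add: X_def add.assoc)
  then show ?thesis
    using back_and_forth_right[OF AB, of i] by (simp add: X_def add_ac)
qed

text \<open>A morphism that sends the final leg into the initial one and the initial leg into the final one
  has all its values in the overlap \<open>{a..a + k}\<close>. So it is the inclusion of the overlap after a map \<open>r\<close>
  into \<open>[k]\<close>, and \<open>r\<close> maps overlap onto overlap if \<open>[k]\<close> is covered by \<open>[k]\<close> and \<open>[k]\<close>. Both factors
  restrict to the same simplex \<open>Y\<close> on the overlap, \<open>Y\<close> is its own composite with itself, and naturality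
  along \<open>r\<close> gives the claim.\<close>

lemma comp_natural_crossed:
  assumes mor: "bicovering_morphism Delta
      (t (k' + b') (a' + k' + b')) (s (a' + k') (a' + k' + b'))
      (s (a + k) (a + k + b)) (t (k + b) (a + k + b)) qa qb qc"
    and AB: "(A, B) \<in> composable_pairs C k (a + k) (k + b)"
  shows "res C qc (comp (k, a + k, k + b) (A, B)) = comp (k', a' + k', k' + b') (res C qb B, res C qa A)"
    and "(res C qb B, res C qa A) \<in> composable_pairs C k' (a' + k') (k' + b')"
proof -
  note C = simplicial_set
  have A: "A \<in> sec C (a + k)" and B: "B \<in> sec C (k + b)"
    and eq: "res C (ordinal_map k (a + k) (\<lambda>v. v + a)) A = res C (ordinal_map k (k + b) (\<lambda>v. v)) B"
    using AB by (simp_all add: composable_pairs_iff[OF C])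
  obtain p p' u v where H: "qa \<in> Hom Delta (k' + b') (a + k)" "qb \<in> Hom Delta (a' + k') (k + b)"
     "qc \<in> Hom Delta (a' + k' + b') (a + k + b)"
    and L: "qc \<cdot>\<^bsub>Delta\<^esub> t (k' + b') (a' + k' + b') = s (a + k) (a + k + b) \<cdot>\<^bsub>Delta\<^esub> qa"
    and R: "qc \<cdot>\<^bsub>Delta\<^esub> s (a' + k') (a' + k' + b') = t (k + b) (a + k + b) \<cdot>\<^bsub>Delta\<^esub> qb"
    and pb: "is_pullback Delta (s (a + k) (a + k + b)) (t (k + b) (a + k + b)) p p'"
    and uv: "u \<in> Hom Delta (Dom Delta p) (k' + b')" "v \<in> Hom Delta (Dom Delta p) (a' + k')"
    and sq: "t (k' + b') (a' + k' + b') \<cdot>\<^bsub>Delta\<^esub> u = s (a' + k') (a' + k' + b') \<cdot>\<^bsub>Delta\<^esub> v"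
    and vp: "qb \<cdot>\<^bsub>Delta\<^esub> v = p'"
    by (rule bicovering_morphismE[OF mor, unfolded Dom_Cod_s_t]) (rule that)
  note pq = pullback_s_t_unique[OF pb]
  obtain f where f: "qa = ordinal_map (k' + b') (a + k) f" "order_preserving (k' + b') (a + k) f"
    using H(1) by (rule Hom_DeltaE)
  obtain g where g: "qb = ordinal_map (a' + k') (k + b) g" "order_preserving (a' + k') (k + b) g"
    using H(2) by (rule Hom_DeltaE)
  obtain q where q: "qc = ordinal_map (a' + k' + b') (a + k + b) q"
      "order_preserving (a' + k' + b') (a + k + b) q"
    using H(3) by (rule Hom_DeltaE)
  obtain u' where u': "u = ordinal_map k (k' + b') u'" "order_preserving k (k' + b') u'"
    using uv(1) unfolding pq Dom_Cod_s_t by (rule Hom_DeltaE)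
  obtain v' where v': "v = ordinal_map k (a' + k') v'" "order_preserving k (a' + k') v'"
    using uv(2) unfolding pq Dom_Cod_s_t by (rule Hom_DeltaE)
  have f_eq: "q (x + a') = f x" if "x \<le> k' + b'" for x
    using L f q that by (simp add: s_eq t_eq)
  have g_eq: "q x = g x + a" if "x \<le> a' + k'" for x
    using R g q that by (simp add: s_eq t_eq)
  have uv_eq: "u' x + a' = v' x" if "x \<le> k" for x
    using sq u' v' that by (simp add: s_eq t_eq)
  have gv: "g (v' x) = x" if "x \<le> k" for x
    using vp pq g v' that by (simp add: s_eq)
  have lo: "a \<le> q x" if "x \<le> a' + k' + b'" for x
    using g_eq[of 0] q(2) that unfolding order_preserving_def by (metis add_leD2 le0 le_trans)
  have hi: "q x \<le> a + k" if "x \<le> a' + k' + b'" for x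
  proof -
    have "q x \<le> q (k' + b' + a')" using q(2) that by (simp add: order_preserving_def add_ac)
    also have "\<dots> \<le> a + k" using f_eq[of "k' + b'"] f(2) by (simp add: order_preserving_def)
    finally show ?thesis .
  qed
  \<comment> \<open>\<open>q\<close> corestricted to the overlap, which starts at \<open>a\<close>\<close>
  define r where "r = (\<lambda>x. q x - a)"
  have r_eq: "q x = r x + a" if "x \<le> a' + k' + b'" for x
    using lo[OF that] by (simp add: r_def)
  have opr: "order_preserving (a' + k' + b') k r"
    unfolding order_preserving_def
  proof (intro conjI allI impI)
    fix x assume "x \<le> a' + k' + b'" then show "r x \<le> k" using hi[of x] by (simp add: r_def)
  next
    fix x y assume "x \<le> y" "y \<le> a' + k' + b'" then show "r x \<le> r y"
      using q(2) by (auto simp: r_def order_preserving_def diff_le_mono)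
  qed
  have po: "preserves_overlap a' k' b' 0 k 0 r"
    unfolding preserves_overlap_def
  proof (intro conjI allI impI)
    show "order_preserving (a' + k' + b') (0 + k + 0) r" using opr by simp
    show "r (a' + k') \<le> 0 + k" using opr by (simp add: order_preserving_def)
    show "0 \<le> r a'" by simp
    fix x :: nat assume "x \<le> 0 + k"
    then have x: "x \<le> k" by simp
    have "v' x \<le> a' + k'" using v'(2) x by (simp add: order_preserving_def)
    moreover have "a' \<le> v' x" using uv_eq[OF x] by simp
    moreover have "r (v' x) = x" using g_eq[of "v' x"] gv[OF x] \<open>v' x \<le> a' + k'\<close> by (simp add: r_def)
    ultimately show "\<exists>y. a' \<le> y \<and> y \<le> a' + k' \<and> r y = x" by blast
  qed
  define Y where "Y = res C (ordinal_map k (a + k) (\<lambda>v. v + a)) A"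
  have Y: "Y \<in> sec C k" using A by (simp add: Y_def res_in_sec[OF C])
  have YY: "(Y, Y) \<in> composable_pairs C k (0 + k) (k + 0)"
    using Y by (simp add: composable_pairs_diagonal[OF C])
  have compY: "comp (k, k, k) (Y, Y) = Y"
    using identity_left[OF Y, of k] Y by (simp add: s_eq res_id[OF C])
  have rl: "order_preserving (a' + k') k r" and rr: "order_preserving (k' + b') k (\<lambda>v. r (v + a'))"
    using preserves_overlapD(2,3)[OF po] by simp_all
  have qb_eq: "res C qb B = res C (ordinal_map (a' + k') k r) Y"
  proof -
    have "qb = ordinal_map (a' + k') (k + b) r"
      using g(1) g_eq by (simp add: r_def)
    then show ?thesis using rl B by (simp add: Y_def eq res_res[OF C])
  qed
  have qa_eq: "res C qa A = res C (ordinal_map (k' + b') k (\<lambda>v. r (v + a'))) Y"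
  proof -
    have "qa = ordinal_map (k' + b') (a + k) (\<lambda>v. r (v + a') + a)"
      using f(1) f_eq r_eq by simp
    then show ?thesis using rr A by (simp add: Y_def res_res[OF C])
  qed
  have "res C qc (comp (k, a + k, k + b) (A, B)) = res C (ordinal_map (a' + k' + b') k r) Y"
  proof -
    have Y2: "Y = res C (ordinal_map k (a + k + b) (\<lambda>v. v + a)) (comp (k, a + k, k + b) (A, B))"
    proof -
      have "Y = res C (ordinal_map k (a + k) (\<lambda>v. v + a)) (res C (s (a + k) (a + k + b)) (comp (k, a + k, k + b) (A, B)))"
        by (simp only: Y_def initial_comp[OF AB])
      then show ?thesis using comp_in_sec[OF AB] by (simp add: s_eq res_res[OF C])
    qed
    have "qc = ordinal_map (a' + k' + b') (a + k + b) (\<lambda>v. r v + a)"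
      using q(1) r_eq by simp
    then show ?thesis unfolding Y2 using opr comp_in_sec[OF AB] by (simp add: res_res[OF C])
  qed
  also have "\<dots> = comp (k', a' + k', k' + b') (res C qb B, res C qa A)"
    using comp_natural[OF po YY] compY by (simp add: qa_eq qb_eq)
  finally show "res C qc (comp (k, a + k, k + b) (A, B)) = comp (k', a' + k', k' + b') (res C qb B, res C qa A)" .
  show "(res C qb B, res C qa A) \<in> composable_pairs C k' (a' + k') (k' + b')"
    using composable_restrict[OF C po YY] by (simp add: qa_eq qb_eq)
qed

lemma gluing_natural:
  assumes J': "(f', g') \<in> Delta_bicoverings"
    and mor: "bicovering_morphism Delta f' g' (s (a + k) (a + k + b)) (t (k + b) (a + k + b)) qa qb qc"
    and AB: "(A, B) \<in> composable_pairs C k (a + k) (k + b)"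
  shows "res C qc (gluing (s (a + k) (a + k + b), t (k + b) (a + k + b)) (A, B)) = gluing (f', g') (res C qa A, res C qb B)"
    and "(res C qa A, res C qb B) \<in> fibre_product Delta C f' g'"
proof -
  have "res C qc (gluing (s (a + k) (a + k + b), t (k + b) (a + k + b)) (A, B)) = gluing (f', g') (res C qa A, res C qb B)
    \<and> (res C qa A, res C qb B) \<in> fibre_product Delta C f' g'"
    using J'
  proof (cases rule: Delta_bicoveringsE)
    case (initial_final a' k' b')
    obtain q where q: "preserves_overlap a' k' b' a k b q"
      "qa = ordinal_map (a' + k') (a + k) q"
      "qb = ordinal_map (k' + b') (k + b) (\<lambda>v. q (v + a') - a)"
      "qc = ordinal_map (a' + k' + b') (a + k + b) q"
      using mor unfolding initial_final by (rule map_of_bicovering_morphism)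
    show ?thesis
      using composable_restrict[OF simplicial_set q(1) AB] comp_natural[OF q(1) AB] AB
      unfolding initial_final fibre_product_s_t[OF simplicial_set] q(2-4)
      by (simp add: gluing_initial_final)
  next
    case (final_initial a' k' b')
    note N = comp_natural_crossed[OF mor[unfolded final_initial] AB]
    show ?thesis
      using N unfolding final_initial
      by (simp add: gluing_initial_final[OF AB] gluing_final_initial[OF N(2)] fibre_product_t_s[OF simplicial_set])
  qed
  then show "res C qc (gluing (s (a + k) (a + k + b), t (k + b) (a + k + b)) (A, B)) = gluing (f', g') (res C qa A, res C qb B)"
    and "(res C qa A, res C qb B) \<in> fibre_product Delta C f' g'" by blast+
qed

lemma gluing_identity:
  assumes J: "(Ident Delta c, g) \<in> Delta_bicoverings"
    and AB: "(A, B) \<in> fibre_product Delta C (Ident Delta c) g"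
  shows "gluing (Ident Delta c, g) (A, B) = A"
  using J
proof (cases rule: Delta_bicoveringsE)
  case (initial_final a k b)
  then have b: "b = 0" by (auto simp: s_eq Ident_eq)
  have AB': "(A, B) \<in> composable_pairs C k (a + k) (k + b)"
    using AB unfolding initial_final fibre_product_s_t[OF simplicial_set] .
  have "gluing (Ident Delta c, g) (A, B) = comp (k, a + k, k) (A, B)"
    using gluing_initial_final[OF AB'] initial_final b by simp
  moreover have "res C (t k (a + k)) A = B" "A \<in> sec C (a + k)"
    using AB'[unfolded composable_pairs_iff[OF simplicial_set]] b by (simp_all add: t_eq res_id[OF simplicial_set])
  ultimately show ?thesis using identity_right[of A "a + k" k] by simp
next
  case (final_initial a k b)
  then have a: "a = 0" by (auto simp: t_eq Ident_eq)
  have AB': "(B, A) \<in> composable_pairs C k (a + k) (k + b)"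
    using AB unfolding final_initial by (simp add: fibre_product_t_s[OF simplicial_set])
  have "gluing (Ident Delta c, g) (A, B) = comp (k, k, k + b) (B, A)"
    using gluing_final_initial[OF AB'] final_initial a by simp
  moreover have "res C (s k (k + b)) A = B" "A \<in> sec C (k + b)"
    using AB'[unfolded composable_pairs_iff[OF simplicial_set]] a by (simp_all add: s_eq) (metis res_id[OF simplicial_set])
  ultimately show ?thesis using identity_left[of A "k + b" k] by simp
qed

text \<open>By uniqueness of pullbacks, \<open>p\<close> is the inclusion of the overlap in the domain of \<open>f\<close>. If \<open>h\<close> is the
  complementary segment, this is back-and-forth for \<open>comp\<close>. The other orientation, in which \<open>p\<close> and \<open>h\<close>
  have exchanged forms, needs \<open>p\<close> to be an initial and a final segment at once; then \<open>g\<close> is an identity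
  and the identity law suffices.\<close>

lemma gluing_back_and_forth:
  assumes J: "(f, g) \<in> Delta_bicoverings" and pb: "is_pullback Delta f g p q"
    and h: "(h, p) \<in> Delta_bicoverings"
    and AB: "(A, B) \<in> fibre_product Delta C (f \<cdot>\<^bsub>Delta\<^esub> h) g"
    and X_in: "gluing (f \<cdot>\<^bsub>Delta\<^esub> h, g) (A, B) \<in> sec C (Cod Delta f)"
  defines "X \<equiv> gluing (f \<cdot>\<^bsub>Delta\<^esub> h, g) (A, B)"
  shows "gluing (f, g) (res C f X, res C g X) = X"
  using J
proof (cases rule: Delta_bicoveringsE)
  case (initial_final a k b)
  have X: "X \<in> sec C (a + k + b)" using X_in initial_final by (simp add: X_def)
  note fgX = gluing_initial_final[OF restrictions_composable[OF X]]
  have p: "p = t k (a + k)" using pullback_s_t_unique(1) pb unfolding initial_final by blast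
  \<comment> \<open>For \<open>a = 0\<close> the leg \<open>g\<close> is an identity; otherwise the inclusion \<open>p\<close> of the overlap has only one form,
    which determines \<open>h\<close>.\<close>
  show ?thesis
  proof (cases "a = 0")
    case True
    have "comp (k, k, k + b) (res C (s k (k + b)) X, X) = X"
      using identity_left[of X "k + b" k] X True by simp
    then show ?thesis
      using fgX X True unfolding initial_final by (simp add: t_eq res_id[OF simplicial_set])
  next
    case False
    obtain k1 i where k: "k = k1 + i" and h: "h = s (a + k1) (a + k)"
      using h unfolding p
    proof (cases rule: Delta_bicoveringsE)
      case (initial_final a1 k1 b1)
      then have "a = a1" "k = k1 + b1" by (auto simp: t_eq)
      then show thesis using that[of k1 b1] initial_final by (simp add: add.assoc)
    next
      case (final_initial a1 k1 b1)
      then have "a = 0" by (auto simp: t_eq s_eq)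
      then show thesis using False by simp
    qed
    have fh: "f \<cdot>\<^bsub>Delta\<^esub> h = s (a + k1) (a + k1 + (i + b))"
      and g: "g = t (k1 + (i + b)) (a + k1 + (i + b))"
      using initial_final h k by (simp_all add: s_eq add.assoc)
    have AB': "(A, B) \<in> composable_pairs C k1 (a + k1) (k1 + (i + b))"
      using AB unfolding fh g fibre_product_s_t[OF simplicial_set] .
    have "X = comp (k1, a + k1, k1 + (i + b)) (A, B)"
      unfolding X_def fh g by (rule gluing_initial_final[OF AB'])
    then have "comp (k, a + k, k + b) (res C (s (a + k) (a + k + b)) X, res C (t (k + b) (a + k + b)) X) = X"
      using extend_initial[OF AB'] unfolding k by simp
    then show ?thesis using fgX unfolding initial_final by simp
  qed
next
  case (final_initial a k b)
  have X: "X \<in> sec C (a + k + b)" using X_in final_initial by (simp add: X_def)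
  note fgX = gluing_final_initial[OF restrictions_composable[OF X]]
  have p: "p = s k (k + b)"
    using pullback_s_t_unique(2)[OF is_pullback_swap] pb unfolding final_initial by blast
  \<comment> \<open>For \<open>b = 0\<close> the leg \<open>g\<close> is an identity; otherwise the inclusion \<open>p\<close> of the overlap has only one form,
    which determines \<open>h\<close>.\<close>
  show ?thesis
  proof (cases "b = 0")
    case True
    have "comp (k, a + k, k) (X, res C (t k (a + k)) X) = X"
      using identity_right[of X "a + k" k] X True by simp
    then show ?thesis
      using fgX X True unfolding final_initial by (simp add: s_eq res_id[OF simplicial_set])
  next
    case False
    obtain k1 i where k: "k = i + k1" and h: "h = t (k1 + b) (k + b)"
      using h unfolding p
    proof (cases rule: Delta_bicoveringsE)
      case (initial_final a1 k1 b1)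
      then have "a1 = 0" "k = k1 + b1" "k + b = a1 + k1 + b1" by (auto simp: t_eq s_eq)
      then show thesis using False by simp
    next
      case (final_initial a1 k1 b1)
      then have "k = a1 + k1" "b = b1" by (auto simp: s_eq)
      then show thesis using that[of a1 k1] final_initial by (simp add: add.assoc)
    qed
    have fh: "f \<cdot>\<^bsub>Delta\<^esub> h = t (k1 + b) (a + i + k1 + b)"
      and g: "g = s (a + i + k1) (a + i + k1 + b)"
      using final_initial h k by (simp_all add: s_eq t_eq add.assoc)
    have AB': "(B, A) \<in> composable_pairs C k1 (a + i + k1) (k1 + b)"
      using AB unfolding fh g by (simp add: fibre_product_t_s[OF simplicial_set])
    have "X = comp (k1, a + i + k1, k1 + b) (B, A)"
      unfolding X_def fh g by (rule gluing_final_initial[OF AB'])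
    then have "comp (k, a + k, k + b) (res C (s (a + k) (a + k + b)) X, res C (t (k + b) (a + k + b)) X) = X"
      using extend_final[OF AB'] unfolding k by simp
    then show ?thesis using fgX unfolding final_initial by simp
  qed
qed

lemma gluing_in_sec:
  assumes J: "(f, g) \<in> Delta_bicoverings" and AB: "(A, B) \<in> fibre_product Delta C f g"
  shows "gluing (f, g) (A, B) \<in> sec C (Cod Delta f)"
  using J
proof (cases rule: Delta_bicoveringsE)
  case (initial_final a k b)
  then show ?thesis
    using AB comp_in_sec by (simp add: fibre_product_s_t[OF simplicial_set] gluing_initial_final)
next
  case (final_initial a k b)
  then have "(B, A) \<in> composable_pairs C k (a + k) (k + b)"
    using AB by (simp add: fibre_product_t_s[OF simplicial_set])
  then show ?thesis
    using final_initial comp_in_sec by (simp add: gluing_final_initial)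
qed

lemma gleaf_gluing: "gleaf Delta Delta_bicoverings C gluing"
proof (rule gleaf.intro[OF simplicial_set], rule gleaf_axioms.intro)
  show "gluing \<in> (\<Pi>\<^sub>E (f, g) \<in> Delta_bicoverings. fibre_product Delta C f g \<rightarrow>\<^sub>E sec C (Cod Delta f))"
  proof (rule PiE_I)
    fix x assume x: "x \<in> Delta_bicoverings"
    obtain f g where fg: "x = (f, g)" by (cases x)
    have "gluing (f, g) \<in> fibre_product Delta C f g \<rightarrow>\<^sub>E sec C (Cod Delta f)"
    proof (rule PiE_I)
      fix y assume "y \<in> fibre_product Delta C f g"
      then show "gluing (f, g) y \<in> sec C (Cod Delta f)"
        using gluing_in_sec[of f g] x fg by (cases y) simp
    next
      fix y assume "y \<notin> fibre_product Delta C f g"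
      then show "gluing (f, g) y = undefined"
        using x fg by (simp add: gluing_of_composition_def)
    qed
    then show "gluing x \<in> (case x of (f, g) \<Rightarrow> fibre_product Delta C f g \<rightarrow>\<^sub>E sec C (Cod Delta f))"
      using fg by simp
  qed (simp add: gluing_of_composition_def)
next
  fix f g A B
  assume "(f, g) \<in> Delta_bicoverings" "(A, B) \<in> fibre_product Delta C f g"
  then show "gluing (g, f) (B, A) = gluing (f, g) (A, B)" by (rule gluing_swap)
next
  fix a g A B
  assume "(Ident Delta a, g) \<in> Delta_bicoverings" "(A, B) \<in> fibre_product Delta C (Ident Delta a) g"
  then show "gluing (Ident Delta a, g) (A, B) = A" by (rule gluing_identity)
next
  fix f b A B
  assume J: "(f, Ident Delta b) \<in> Delta_bicoverings" and AB: "(A, B) \<in> fibre_product Delta C f (Ident Delta b)"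
  have "(Ident Delta b, f) \<in> Delta_bicoverings"
    using J unfolding Delta_bicoverings_def by blast
  moreover have "(B, A) \<in> fibre_product Delta C (Ident Delta b) f"
    using AB by (simp only: fibre_product_swap)
  ultimately show "gluing (f, Ident Delta b) (A, B) = B"
    using gluing_swap[OF J AB] gluing_identity by metis
next
  fix f g p q h A B
  assume J: "(f, g) \<in> Delta_bicoverings" and pb: "is_pullback Delta f g p q"
    and h: "(h, p) \<in> Delta_bicoverings" and J': "(f \<cdot>\<^bsub>Delta\<^esub> h, g) \<in> Delta_bicoverings"
    and AB: "(A, B) \<in> fibre_product Delta C (f \<cdot>\<^bsub>Delta\<^esub> h) g"
  have "Cod Delta (f \<cdot>\<^bsub>Delta\<^esub> h) = Cod Delta f"
    by (simp add: Delta_def split_beta)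
  then have "gluing (f \<cdot>\<^bsub>Delta\<^esub> h, g) (A, B) \<in> sec C (Cod Delta f)"
    using gluing_in_sec[OF J' AB] by simp
  then show "gluing (f, g) (res C f (gluing (f \<cdot>\<^bsub>Delta\<^esub> h, g) (A, B)), res C g (gluing (f \<cdot>\<^bsub>Delta\<^esub> h, g) (A, B)))
      = gluing (f \<cdot>\<^bsub>Delta\<^esub> h, g) (A, B)"
    by (rule gluing_back_and_forth[OF J pb h AB])
next
  fix f' g' f g qa qb qc A B
  assume J': "(f', g') \<in> Delta_bicoverings" and J: "(f, g) \<in> Delta_bicoverings"
    and mor: "bicovering_morphism Delta f' g' f g qa qb qc"
    and AB: "(A, B) \<in> fibre_product Delta C f g"
  show "res C qc (gluing (f, g) (A, B)) = gluing (f', g') (res C qa A, res C qb B)"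
    using J
  proof (cases rule: Delta_bicoveringsE)
    case (initial_final a k b)
    show ?thesis
      using gluing_natural(1)[OF J' mor[unfolded initial_final]] AB
      unfolding initial_final fibre_product_s_t[OF simplicial_set] by blast
  next
    case (final_initial a k b)
    have BA: "(B, A) \<in> composable_pairs C k (a + k) (k + b)"
      using AB unfolding final_initial by (simp add: fibre_product_t_s[OF simplicial_set])
    have J'': "(g', f') \<in> Delta_bicoverings"
      using J' unfolding Delta_bicoverings_def by blast
    have "Cod Delta f' = Cod Delta g'"
      using J' by (cases rule: Delta_bicoveringsE) simp_all
    note mor' = bicovering_morphism_swap[OF mor this, unfolded final_initial]
    note N = gluing_natural[OF J'' mor' BA]
    have "res C qc (gluing (f, g) (A, B)) = gluing (g', f') (res C qb B, res C qa A)"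
      using N(1) gluing_swap[OF J AB] unfolding final_initial by simp
    also have "\<dots> = gluing (f', g') (res C qa A, res C qb B)"
      using gluing_swap[OF J'' N(2)] by simp
    finally show ?thesis .
  qed
qed

lemma composition_of_gluing_gluing: "composition_of_gluing gluing = comp"
proof
  fix x :: "nat \<times> nat \<times> nat"
  show "composition_of_gluing gluing x = comp x"
  proof (cases "x \<in> {(k, m, n). k \<le> m \<and> k \<le> n}")
    case False
    then show ?thesis
      using PiE_arb[OF comp_in] by (simp add: composition_of_gluing_def restrict_def)
  next
    case True
    then obtain k a b where x: "x = (k, a + k, k + b)"
      by (auto elim!: overlap_indices)
    have c: "comp (k, a + k, k + b) \<in> composable_pairs C k (a + k) (k + b) \<rightarrow>\<^sub>E sec C (a + k + (k + b) - k)"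
      using PiE_mem[OF comp_in, of "(k, a + k, k + b)"] by simp
    have "gluing (s (a + k) (a + k + b), t (k + b) (a + k + b)) y = comp (k, a + k, k + b) y" for y
    proof (cases "y \<in> composable_pairs C k (a + k) (k + b)")
      case True
      then show ?thesis by (cases y) (simp add: gluing_initial_final)
    next
      case False
      then show ?thesis
        using PiE_arb[OF c False] initial_final_bicovering[of a k b]
        by (simp add: gluing_of_composition_def fibre_product_s_t[OF simplicial_set])
    qed
    then show ?thesis unfolding x composition_of_gluing_apply by (rule ext)
  qed
qed

end

text \<open>The composition sees the gluing on cospans whose first leg is the initial one, the symmetry of
  gluing determines it on the others, and both functions are undefined elsewhere.\<close>

lemma gluing_determined_by_composition:
  assumes G: "gleaf Delta Delta_bicoverings C glue" and G': "gleaf Delta Delta_bicoverings C glue'"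
    and eq: "composition_of_gluing glue = composition_of_gluing glue'"
  shows "glue = glue'"
proof (rule PiE_ext[OF gleaf.glue_in[OF G] gleaf.glue_in[OF G']])
  fix x assume x: "x \<in> Delta_bicoverings"
  obtain f g where fg: "x = (f, g)" by (cases x)
  have straight: "glue (s (a + k) (a + k + b), t (k + b) (a + k + b))
      = glue' (s (a + k) (a + k + b), t (k + b) (a + k + b))" for a k b
    using fun_cong[OF eq, of "(k, a + k, k + b)"] by (simp add: composition_of_gluing_apply)
  have "(f, g) \<in> Delta_bicoverings" using x fg by simp
  then have "glue (f, g) = glue' (f, g)"
  proof (cases rule: Delta_bicoveringsE)
    case (initial_final a k b)
    then show ?thesis using straight by simp
  next
    case (final_initial a k b)
    show ?thesis
    proof (rule PiE_ext)
      show "glue (f, g) \<in> fibre_product Delta C f g \<rightarrow>\<^sub>E sec C (Cod Delta f)"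
        using PiE_mem[OF gleaf.glue_in[OF G] x] fg by simp
      show "glue' (f, g) \<in> fibre_product Delta C f g \<rightarrow>\<^sub>E sec C (Cod Delta f)"
        using PiE_mem[OF gleaf.glue_in[OF G'] x] fg by simp
      fix y assume y: "y \<in> fibre_product Delta C f g"
      obtain A B where AB: "y = (A, B)" by (cases y)
      have "(B, A) \<in> fibre_product Delta C g f"
        using y AB by (simp only: fibre_product_swap)
      moreover have "(g, f) \<in> Delta_bicoverings"
        unfolding final_initial by (rule initial_final_bicovering)
      ultimately have "glue (f, g) (A, B) = glue (g, f) (B, A)" "glue' (f, g) (A, B) = glue' (g, f) (B, A)"
        using gleaf.glue_swap[OF G] gleaf.glue_swap[OF G'] by blast+
      then show "glue (f, g) y = glue' (f, g) y"
        using straight AB final_initial by simp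
    qed
  qed
  then show "glue x = glue' x" using fg by simp
qed

theorem theorem4p3p8:
  "(\<forall>m n j. m \<le> j \<longrightarrow> n \<le> j \<longrightarrow> j \<le> n + m \<longrightarrow>
      is_pullback Delta (s m j) (t n j) (t (m + n - j) m) (s (m + n - j) n)) \<and>
   (\<forall>(C :: 'x sset) k m n. simplicial_set C \<longrightarrow> k \<le> m \<longrightarrow> k \<le> n \<longrightarrow>
      fibre_product Delta C (s m (m + n - k)) (t n (m + n - k)) = composable_pairs C k m n) \<and>
   bij_betw (\<lambda>(C, glue). (C, composition_of_gluing glue))
     {(C :: 'x sset, glue). gleaf Delta Delta_bicoverings C glue}
     {(C :: 'x sset, comp). compository C comp}"
proof (intro conjI allI impI)
  fix m n j :: nat assume "m \<le> j" "n \<le> j" "j \<le> n + m"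
  then show "is_pullback Delta (s m j) (t n j) (t (m + n - j) m) (s (m + n - j) n)"
  proof (rule cospan_indices)
    fix a k b assume *: "m = a + k" "n = k + b" "j = a + k + b" "m + n - j = k"
    show ?thesis unfolding *(4) unfolding *(1-3) by (rule pullback_s_t)
  qed
next
  fix C :: "'x sset" and k m n :: nat
  assume C: "simplicial_set C" and "k \<le> m" "k \<le> n"
  from this(2,3) show "fibre_product Delta C (s m (m + n - k)) (t n (m + n - k)) = composable_pairs C k m n"
  proof (rule overlap_indices)
    fix a b assume *: "m = a + k" "n = k + b" "m + n - k = a + k + b"
    show ?thesis unfolding *(3) unfolding *(1,2) by (rule fibre_product_s_t[OF C])
  qed
next
  show "bij_betw (\<lambda>(C, glue). (C, composition_of_gluing glue))
     {(C :: 'x sset, glue). gleaf Delta Delta_bicoverings C glue}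
     {(C :: 'x sset, comp). compository C comp}"
  proof (rule bij_betw_imageI)
    show "inj_on (\<lambda>(C, glue). (C, composition_of_gluing glue))
       {(C :: 'x sset, glue). gleaf Delta Delta_bicoverings C glue}"
      by (auto simp: inj_on_def intro: gluing_determined_by_composition)
    show "(\<lambda>(C, glue). (C, composition_of_gluing glue))
         ` {(C :: 'x sset, glue). gleaf Delta Delta_bicoverings C glue}
       = {(C :: 'x sset, comp). compository C comp}"
    proof (intro equalityI subsetI)
      fix x :: "'x sset \<times> _"
      assume "x \<in> (\<lambda>(C, glue). (C, composition_of_gluing glue)) ` {(C, glue). gleaf Delta Delta_bicoverings C glue}"
      then show "x \<in> {(C, comp). compository C comp}"
        by (auto intro: compository_of_gleaf)
    next
      fix x :: "'x sset \<times> _"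
      assume "x \<in> {(C, comp). compository C comp}"
      then obtain C cmp where x: "x = (C, cmp)" and c: "compository C cmp" by blast
      show "x \<in> (\<lambda>(C, glue). (C, composition_of_gluing glue)) ` {(C, glue). gleaf Delta Delta_bicoverings C glue}"
        unfolding x
        by (rule image_eqI[of _ _ "(C, gluing_of_composition C cmp)"])
          (simp_all add: compository.gleaf_gluing[OF c] compository.composition_of_gluing_gluing[OF c])
    qed
  qed
qed

end
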